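(* Let $A=\bigoplus_{k\in\mathbb{Z}}A^k$ be a $\mathbb{Z}$-graded $A_\infty$-algebra over a field $\mathbb{K}$ and $h\in A$ a twisting element of positive degree. The filtration $\mathrm{F}^pA=\bigoplus_{n\ge p}A^n$ of the $\mathbb{Z}_2$-graded cochain complex $(A,\partial_h)$ gives a spectral sequence $\{E^{p\bar q}_r,d_r\}$ converging to the twisted cohomology $\mathrm{H}_h(A)$. Moreover, (i) $E^{p\bar1}_r=0$ for any $p\in\mathbb{Z}$ and $r\ge0$; (ii) $d_r=0$ if $r$ is even; (iii) $E^{p\bar0}_{2m}=E^{p\bar0}_{2m+1}$ for any $p\in\mathbb{Z}$ and $m\ge1$; (iv) $E^{p\bar0}_2=E^{p\bar0}_3=\mathrm{H}^p(A)$.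
   Context: $A_\infty$-algebra: a graded $\mathbb{K}$-vector space $A$ with graded multilinear maps $b_n\colon A^{\otimes n}\to A$ ($n\ge1$) of degree $1$ such that for each $n\ge1$, $\sum_{r,t\ge0,\,s\ge1,\,r+s+t=n}b_{r+1+t}\circ(1^{\otimes r}\otimes b_s\otimes1^{\otimes t})=0$ (Koszul sign rule $(f\otimes g)(x\otimes y)=(-1)^{|g||x|}f(x)\otimes g(y)$). $\mathrm{H}^p(A)$ is the $p$-th cohomology of $(A,b_1)$. $A^{\bar k}$ denotes the sum of the $A^n$ with $n\equiv k$ mod $2$, and $\bar k$ is $k$ modulo $2$. For $h\in A$, $\partial_ha=\sum_{n\ge0}b_{n+1}(\underbrace{h,\dots,h}_n,a)$ (the infinite sum is written formally; no convergence condition is stated); a twisting element is $h\in A^{\bar0}$ with $\partial_hh=0$; then $d:=\partial_h$ satisfies $d^2=0$ and $\mathrm{H}_h(A)=\mathrm{H}(A,\partial_h)$ is the ($\mathbb{Z}_2$-graded) twisted cohomology. Positive degree means that all homogeneous components of $h$ have positive degree, i.e. $h\in\bigoplus_{i\ge1}A^{2i}$. Spectral sequence of the filtration, in the $\mathbb{Z}_2$-graded setting: $\mathrm{F}^pA^{\bar k}=\mathrm{F}^pA\cap A^{\bar k}$, $\mathrm{Gr}^pA^{\bar k}=\mathrm{F}^pA^{\bar k}/\mathrm{F}^{p+1}A^{\bar k}$, which is $A^p$ if $p\equiv k$ mod $2$ and $0$ otherwise. For $r\ge0$, $Z^{p\bar q}_r=\{x\in\mathrm{Gr}^pA^{\overline{p+q}}:\exists\,\tilde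 x\in\mathrm{F}^pA^{\overline{p+q}}$ lifting $x$ with $d\tilde x\in\mathrm{F}^{p+r}A\}$, $B^{p\bar q}_r=\{x\in\mathrm{Gr}^pA^{\overline{p+q}}:\exists\,\tilde y\in\mathrm{F}^{p-r+1}A^{\overline{p+q-1}}$ with $d\tilde y\in\mathrm{F}^pA$ and $x=d\tilde y+\mathrm{F}^{p+1}A\}$, $E^{p\bar q}_r=Z^{p\bar q}_r/B^{p\bar q}_r$, and $d_r\colon E^{p\bar q}_r\to E^{p+r,\overline{q-r+1}}_r$ sends $[x]$ to the class of the component of $d\tilde x$ in $\mathrm{Gr}^{p+r}A^{\overline{p+q+1}}$, for a lift $\tilde x$ as in the definition of $Z_r$. Then $d_r^2=0$ and $E_{r+1}$ is the cohomology of $(E_r,d_r)$. Convergence is meant in the usual sense for an exhaustive and weakly convergent filtration. Put $Z^{p\bar q}_\infty=\bigcap_rZ^{p\bar q}_r$, $B^{p\bar q}_\infty=\bigcup_rB^{p\bar q}_r$ and $E^{p\bar q}_\infty=Z^{p\bar q}_\infty/B^{p\bar q}_\infty$. Exhaustive means $\bigcup_p\mathrm{F}^pA=A$. Weakly convergent means that $Z^{p\bar q}_\infty$ is exactly the set of $x\in\mathrm{Gr}^pA^{\overline{p+q}}$ having a lift $\tilde x\in\mathrm{F}^pA^{\overline{p+q}}$ with $d\tilde x=0$. The spectral sequence then converges to $\mathrm{H}_h(A)$: $E^{p\bar q}_\infty$ is the $p$-th graded component of $\mathrm{H}^{\overline{p+q}}_h(A)$ with respect to the filtration by the images of the cohomology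 of $(\mathrm{F}^pA,d)$.
   Formalization: Convergence to the twisted cohomology is proved only when the filtration is weakly convergent (it can fail otherwise, as finite sums in A need not give closed lifts); the series defining the twisted differential is assumed to give an element of A. *)

theory Defs
  imports Complex_Main "HOL-Library.Set_Algebras"
begin

section \<open>Vector spaces on a carrier, and quotients\<close>

text \<open>
  Addition comes from the type class. For a quotient it is addition of sets, which on
  cosets is the addition of cosets: (x + W) + (y + W) = (x + y) + W.
\<close>

record ('k, 'v) vspace =
  carrier :: "'v set"
  vzero :: "'v"
  smult :: "'k \<Rightarrow> 'v \<Rightarrow> 'v"

definition whole :: "('k \<Rightarrow> 'v \<Rightarrow> 'v) \<Rightarrow> ('k, 'v::zero) vspace" where
  "whole scale = \<lparr>carrier = UNIV, vzero = 0, smult = scale\<rparr>"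

definition sub :: "('k, 'v) vspace \<Rightarrow> 'v set \<Rightarrow> ('k, 'v) vspace" where
  "sub V S = V\<lparr>carrier := S\<rparr>"

text \<open>
  The summand W in the scalar multiplication only matters for c = 0, where the
  image of a coset is {0} rather than W.
\<close>

definition quot :: "('k, 'v::plus) vspace \<Rightarrow> 'v set \<Rightarrow> ('k, 'v set) vspace" where
  "quot V W = \<lparr>carrier = (\<lambda>v. v +o W) ` carrier V, vzero = W,
               smult = (\<lambda>c X. smult V c ` X + W)\<rparr>"

definition lin_map ::
    "('k, 'v::plus) vspace \<Rightarrow> ('k, 'w::plus) vspace \<Rightarrow> ('v \<Rightarrow> 'w) \<Rightarrow> bool" where
  "lin_map V V' f \<longleftrightarrow>
     f ` carrier V \<subseteq> carrier V' \<and>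
     (\<forall>x\<in>carrier V. \<forall>y\<in>carrier V. f (x + y) = f x + f y) \<and>
     (\<forall>c. \<forall>x\<in>carrier V. f (smult V c x) = smult V' c (f x))"

definition lin_iso ::
    "('k, 'v::plus) vspace \<Rightarrow> ('k, 'w::plus) vspace \<Rightarrow> ('v \<Rightarrow> 'w) \<Rightarrow> bool" where
  "lin_iso V V' f \<longleftrightarrow> lin_map V V' f \<and> bij_betw f (carrier V) (carrier V')"


section \<open>Graded vector spaces and \<open>A\<^sub>\<infinity>\<close>-algebras\<close>

definition decomposition :: "(int \<Rightarrow> 'a::ab_group_add set) \<Rightarrow> 'a \<Rightarrow> (int \<Rightarrow> 'a) \<Rightarrow> bool" where
  "decomposition A a f \<longleftrightarrow>
     (\<forall>k. f k \<in> A k) \<and> finite {k. f k \<noteq> 0} \<and> a = (\<Sum>k | f k \<noteq> 0. f k)"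

definition hcomp :: "(int \<Rightarrow> 'a::ab_group_add set) \<Rightarrow> int \<Rightarrow> 'a \<Rightarrow> 'a" where
  "hcomp A k a = (THE f. decomposition A a f) k"

text \<open>The whole type is the direct sum of the subspaces \<open>A k\<close>.\<close>

locale graded_vector_space = vector_space scale
  for scale :: "'k::field \<Rightarrow> 'a::ab_group_add \<Rightarrow> 'a" +
  fixes A :: "int \<Rightarrow> 'a set"
  assumes subspace_component: "subspace (A k)"
    and unique_decomposition: "\<exists>!f. decomposition A a f"

text \<open>
  The map \<open>b\<^sub>n\<close> on \<open>A\<^sup>\<otimes>\<^sup>n\<close> is given as the multilinear map \<open>b\<close> on lists of length
  \<open>n \<ge> 1\<close>; the value of \<open>b\<close> at the empty list is never used. In the relation, \<open>b\<^sub>s\<close> has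
  degree 1 and moves past \<open>x\<^sub>1, \<dots>, x\<^sub>r\<close>, which is where the Koszul sign comes from.
\<close>

locale ainfty_algebra = graded_vector_space scale A
  for scale :: "'k::field \<Rightarrow> 'a::ab_group_add \<Rightarrow> 'a" and A :: "int \<Rightarrow> 'a set" +
  fixes b :: "'a list \<Rightarrow> 'a"
  assumes b_add: "b (xs @ (x + y) # ys) = b (xs @ x # ys) + b (xs @ y # ys)"
    and b_scale: "b (xs @ scale c x # ys) = scale c (b (xs @ x # ys))"
    and b_degree: "\<lbrakk>xs \<noteq> []; list_all2 (\<lambda>x k. x \<in> A k) xs ks\<rbrakk> \<Longrightarrow> b xs \<in> A (sum_list ks + 1)"
    and b_relation: "\<lbrakk>xs \<noteq> []; list_all2 (\<lambda>x k. x \<in> A k) xs ks\<rbrakk> \<Longrightarrow>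
      (\<Sum>(r, s, t)\<in>{(r, s, t). s \<ge> 1 \<and> r + s + t = length xs}.
         scale ((-1) powi sum_list (take r ks))
           (b (take r xs @ b (take s (drop r xs)) # drop (r + s) xs))) = 0"

definition dsum_over :: "('k::field \<Rightarrow> 'a::ab_group_add \<Rightarrow> 'a) \<Rightarrow> (int \<Rightarrow> 'a set) \<Rightarrow> int set \<Rightarrow> 'a set" where
  "dsum_over scale A I = module.span scale (\<Union>n\<in>I. A n)"

text \<open>
  Residue classes modulo 2 are represented by arbitrary integers: \<open>parity_part\<close>, and
  everything below that depends on \<open>k\<close> or \<open>q\<close>, only depends on their class modulo 2.
\<close>

definition parity_part :: "('k::field \<Rightarrow> 'a::ab_group_add \<Rightarrow> 'a) \<Rightarrow> (int \<Rightarrow> 'a set) \<Rightarrow> int \<Rightarrow> 'a set" where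
  "parity_part scale A k = dsum_over scale A {n. n mod 2 = k mod 2}"

definition degree_filtration :: "('k::field \<Rightarrow> 'a::ab_group_add \<Rightarrow> 'a) \<Rightarrow> (int \<Rightarrow> 'a set) \<Rightarrow> int \<Rightarrow> 'a set" where
  "degree_filtration scale A p = dsum_over scale A {p..}"

definition cohomology :: "('k::field \<Rightarrow> 'a::ab_group_add \<Rightarrow> 'a) \<Rightarrow> (int \<Rightarrow> 'a set) \<Rightarrow> ('a list \<Rightarrow> 'a)
    \<Rightarrow> int \<Rightarrow> ('k, 'a set) vspace" where
  "cohomology scale A b p =
     quot (sub (whole scale) {x \<in> A p. b [x] = 0}) ((\<lambda>x. b [x]) ` A (p - 1))"


section \<open>Twisting elements\<close>

text \<open>
  A series in \<open>A\<close> is summed degree by degree: in each degree only finitely many terms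
  contribute, and the resulting components are those of an element of the direct sum.
  That this holds for the series defining the twisted differential is part of
  \<open>twisting_element\<close>.
\<close>

definition formal_sums :: "(int \<Rightarrow> 'a::ab_group_add set) \<Rightarrow> (nat \<Rightarrow> 'a) \<Rightarrow> 'a \<Rightarrow> bool" where
  "formal_sums A f y \<longleftrightarrow>
     (\<forall>k. finite {n. hcomp A k (f n) \<noteq> 0} \<and>
          hcomp A k y = (\<Sum>n | hcomp A k (f n) \<noteq> 0. hcomp A k (f n)))"

definition twist_term :: "('a list \<Rightarrow> 'a) \<Rightarrow> 'a \<Rightarrow> 'a \<Rightarrow> nat \<Rightarrow> 'a" where
  "twist_term b h a n = b (replicate n h @ [a])"

definition twist_diff :: "(int \<Rightarrow> 'a::ab_group_add set) \<Rightarrow> ('a list \<Rightarrow> 'a) \<Rightarrow> 'a \<Rightarrow> 'a \<Rightarrow> 'a" where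
  "twist_diff A b h a = (THE y. formal_sums A (twist_term b h a) y)"

definition twist_defined :: "(int \<Rightarrow> 'a::ab_group_add set) \<Rightarrow> ('a list \<Rightarrow> 'a) \<Rightarrow> 'a \<Rightarrow> bool" where
  "twist_defined A b h \<longleftrightarrow> (\<forall>a. \<exists>y. formal_sums A (twist_term b h a) y)"

definition twisting_element :: "('k::field \<Rightarrow> 'a::ab_group_add \<Rightarrow> 'a) \<Rightarrow> (int \<Rightarrow> 'a set)
    \<Rightarrow> ('a list \<Rightarrow> 'a) \<Rightarrow> 'a \<Rightarrow> bool" where
  "twisting_element scale A b h \<longleftrightarrow>
     h \<in> parity_part scale A 0 \<and> twist_defined A b h \<and> twist_diff A b h h = 0"

definition positive_degree :: "('k::field \<Rightarrow> 'a::ab_group_add \<Rightarrow> 'a) \<Rightarrow> (int \<Rightarrow> 'a set) \<Rightarrow> 'a \<Rightarrow> bool" where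
  "positive_degree scale A h \<longleftrightarrow> h \<in> dsum_over scale A {2 * i |i. i \<ge> 1}"


section \<open>The spectral sequence of a filtered \<open>\<int>\<^sub>2\<close>-graded complex\<close>

text \<open>
  \<open>P k\<close> is the part of parity \<open>k\<close>, \<open>F p\<close> the \<open>p\<close>-th filtration step and \<open>d\<close> the
  differential; the ambient vector space is the whole type.
\<close>

definition filtered_Z2_complex :: "('k::field \<Rightarrow> 'a::ab_group_add \<Rightarrow> 'a) \<Rightarrow> (int \<Rightarrow> 'a set)
    \<Rightarrow> (int \<Rightarrow> 'a set) \<Rightarrow> ('a \<Rightarrow> 'a) \<Rightarrow> bool" where
  "filtered_Z2_complex scale F P d \<longleftrightarrow>
     (\<forall>k. module.subspace scale (P k) \<and> P (k + 2) = P k \<and> P k \<inter> P (k + 1) = {0} \<and>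
          P k + P (k + 1) = UNIV) \<and>
     (\<forall>p. module.subspace scale (F p) \<and> F (p + 1) \<subseteq> F p \<and>
          F p = (F p \<inter> P 0) + (F p \<inter> P 1)) \<and>
     Vector_Spaces.linear scale scale d \<and>
     (\<forall>x. d (d x) = 0) \<and> (\<forall>k. d ` P k \<subseteq> P (k + 1)) \<and> (\<forall>p. d ` F p \<subseteq> F p)"

definition Gr :: "('k \<Rightarrow> 'a \<Rightarrow> 'a) \<Rightarrow> (int \<Rightarrow> 'a::ab_group_add set) \<Rightarrow> (int \<Rightarrow> 'a set)
    \<Rightarrow> int \<Rightarrow> int \<Rightarrow> ('k, 'a set) vspace" where
  "Gr scale F P p k = quot (sub (whole scale) (F p \<inter> P k)) (F (p + 1) \<inter> P k)"

definition ss_Z :: "('k \<Rightarrow> 'a \<Rightarrow> 'a) \<Rightarrow> (int \<Rightarrow> 'a::ab_group_add set) \<Rightarrow> (int \<Rightarrow> 'a set)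
    \<Rightarrow> ('a \<Rightarrow> 'a) \<Rightarrow> nat \<Rightarrow> int \<Rightarrow> int \<Rightarrow> 'a set set" where
  "ss_Z scale F P d r p q =
     {X \<in> carrier (Gr scale F P p (p + q)).
        \<exists>x \<in> F p \<inter> P (p + q). X = x +o (F (p + 1) \<inter> P (p + q)) \<and> d x \<in> F (p + int r)}"

definition ss_B :: "('k \<Rightarrow> 'a \<Rightarrow> 'a) \<Rightarrow> (int \<Rightarrow> 'a::ab_group_add set) \<Rightarrow> (int \<Rightarrow> 'a set)
    \<Rightarrow> ('a \<Rightarrow> 'a) \<Rightarrow> nat \<Rightarrow> int \<Rightarrow> int \<Rightarrow> 'a set set" where
  "ss_B scale F P d r p q =
     {X \<in> carrier (Gr scale F P p (p + q)).
        \<exists>y \<in> F (p - int r + 1) \<inter> P (p + q - 1).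
          d y \<in> F p \<and> X = d y +o (F (p + 1) \<inter> P (p + q))}"

definition ss_E :: "('k \<Rightarrow> 'a \<Rightarrow> 'a) \<Rightarrow> (int \<Rightarrow> 'a::ab_group_add set) \<Rightarrow> (int \<Rightarrow> 'a set)
    \<Rightarrow> ('a \<Rightarrow> 'a) \<Rightarrow> nat \<Rightarrow> int \<Rightarrow> int \<Rightarrow> ('k, 'a set set) vspace" where
  "ss_E scale F P d r p q =
     quot (sub (Gr scale F P p (p + q)) (ss_Z scale F P d r p q)) (ss_B scale F P d r p q)"

text \<open>The class in \<open>E\<^sub>r\<close> of the class in \<open>Gr\<close> of an element of the filtered complex.\<close>

definition ss_class :: "('k \<Rightarrow> 'a \<Rightarrow> 'a) \<Rightarrow> (int \<Rightarrow> 'a::ab_group_add set) \<Rightarrow> (int \<Rightarrow> 'a set)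
    \<Rightarrow> ('a \<Rightarrow> 'a) \<Rightarrow> nat \<Rightarrow> int \<Rightarrow> int \<Rightarrow> 'a \<Rightarrow> 'a set set" where
  "ss_class scale F P d r p q x =
     (x +o (F (p + 1) \<inter> P (p + q))) +o ss_B scale F P d r p q"

definition ss_d :: "('k \<Rightarrow> 'a \<Rightarrow> 'a) \<Rightarrow> (int \<Rightarrow> 'a::ab_group_add set) \<Rightarrow> (int \<Rightarrow> 'a set)
    \<Rightarrow> ('a \<Rightarrow> 'a) \<Rightarrow> nat \<Rightarrow> int \<Rightarrow> int \<Rightarrow> 'a set set \<Rightarrow> 'a set set" where
  "ss_d scale F P d r p q \<xi> =
     (THE \<eta>. \<exists>x \<in> F p \<inter> P (p + q). d x \<in> F (p + int r) \<and>
        \<xi> = ss_class scale F P d r p q x \<and>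
        \<eta> = ss_class scale F P d r (p + int r) (q - int r + 1) (d x))"

text \<open>The cohomology of \<open>(E\<^sub>r, d\<^sub>r)\<close> at position \<open>(p, q)\<close>.\<close>

definition ss_cohomology :: "('k \<Rightarrow> 'a \<Rightarrow> 'a) \<Rightarrow> (int \<Rightarrow> 'a::ab_group_add set) \<Rightarrow> (int \<Rightarrow> 'a set)
    \<Rightarrow> ('a \<Rightarrow> 'a) \<Rightarrow> nat \<Rightarrow> int \<Rightarrow> int \<Rightarrow> ('k, 'a set set set) vspace" where
  "ss_cohomology scale F P d r p q =
     quot
       (sub (ss_E scale F P d r p q)
         {\<xi> \<in> carrier (ss_E scale F P d r p q).
            ss_d scale F P d r p q \<xi> =
              vzero (ss_E scale F P d r (p + int r) (q - int r + 1))})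
       (ss_d scale F P d r (p - int r) (q + int r - 1) `
         carrier (ss_E scale F P d r (p - int r) (q + int r - 1)))"

text \<open>
  The conjuncts say that \<open>d\<^sub>r\<close> is linear, is given by \<open>d\<close> on any admissible lift (hence is
  well defined), squares to zero, and that the identity on lifts induces an isomorphism
  from \<open>E\<^sub>r\<^sub>+\<^sub>1\<close> to the cohomology of \<open>(E\<^sub>r, d\<^sub>r)\<close>.
\<close>

definition is_spectral_sequence :: "('k \<Rightarrow> 'a \<Rightarrow> 'a) \<Rightarrow> (int \<Rightarrow> 'a::ab_group_add set)
    \<Rightarrow> (int \<Rightarrow> 'a set) \<Rightarrow> ('a \<Rightarrow> 'a) \<Rightarrow> bool" where
  "is_spectral_sequence scale F P d \<longleftrightarrow>
     (\<forall>r p q.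
        lin_map (ss_E scale F P d r p q) (ss_E scale F P d r (p + int r) (q - int r + 1))
          (ss_d scale F P d r p q) \<and>
        (\<forall>x \<in> F p \<inter> P (p + q). d x \<in> F (p + int r) \<longrightarrow>
           ss_d scale F P d r p q (ss_class scale F P d r p q x) =
             ss_class scale F P d r (p + int r) (q - int r + 1) (d x)) \<and>
        (\<forall>\<xi> \<in> carrier (ss_E scale F P d r p q).
           ss_d scale F P d r (p + int r) (q - int r + 1) (ss_d scale F P d r p q \<xi>) =
             vzero (ss_E scale F P d r (p + 2 * int r) (q - 2 * int r + 2))) \<and>
        (\<exists>f. lin_iso (ss_E scale F P d (Suc r) p q) (ss_cohomology scale F P d r p q) f \<and>
           (\<forall>x \<in> F p \<inter> P (p + q). d x \<in> F (p + int (Suc r)) \<longrightarrow>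
              f (ss_class scale F P d (Suc r) p q x) =
                ss_class scale F P d r p q x +o
                  (ss_d scale F P d r (p - int r) (q + int r - 1) `
                    carrier (ss_E scale F P d r (p - int r) (q + int r - 1))))))"


section \<open>Convergence\<close>

definition ss_Z_inf :: "('k \<Rightarrow> 'a \<Rightarrow> 'a) \<Rightarrow> (int \<Rightarrow> 'a::ab_group_add set) \<Rightarrow> (int \<Rightarrow> 'a set)
    \<Rightarrow> ('a \<Rightarrow> 'a) \<Rightarrow> int \<Rightarrow> int \<Rightarrow> 'a set set" where
  "ss_Z_inf scale F P d p q = (\<Inter>r. ss_Z scale F P d r p q)"

definition ss_B_inf :: "('k \<Rightarrow> 'a \<Rightarrow> 'a) \<Rightarrow> (int \<Rightarrow> 'a::ab_group_add set) \<Rightarrow> (int \<Rightarrow> 'a set)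
    \<Rightarrow> ('a \<Rightarrow> 'a) \<Rightarrow> int \<Rightarrow> int \<Rightarrow> 'a set set" where
  "ss_B_inf scale F P d p q = (\<Union>r. ss_B scale F P d r p q)"

definition ss_E_inf :: "('k \<Rightarrow> 'a \<Rightarrow> 'a) \<Rightarrow> (int \<Rightarrow> 'a::ab_group_add set) \<Rightarrow> (int \<Rightarrow> 'a set)
    \<Rightarrow> ('a \<Rightarrow> 'a) \<Rightarrow> int \<Rightarrow> int \<Rightarrow> ('k, 'a set set) vspace" where
  "ss_E_inf scale F P d p q =
     quot (sub (Gr scale F P p (p + q)) (ss_Z_inf scale F P d p q)) (ss_B_inf scale F P d p q)"

definition exhaustive :: "(int \<Rightarrow> 'a set) \<Rightarrow> bool" where
  "exhaustive F \<longleftrightarrow> (\<Union>p. F p) = UNIV"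

definition weakly_convergent :: "('k \<Rightarrow> 'a \<Rightarrow> 'a) \<Rightarrow> (int \<Rightarrow> 'a::ab_group_add set)
    \<Rightarrow> (int \<Rightarrow> 'a set) \<Rightarrow> ('a \<Rightarrow> 'a) \<Rightarrow> bool" where
  "weakly_convergent scale F P d \<longleftrightarrow>
     (\<forall>p q. ss_Z_inf scale F P d p q =
        {X \<in> carrier (Gr scale F P p (p + q)).
           \<exists>x \<in> F p \<inter> P (p + q). X = x +o (F (p + 1) \<inter> P (p + q)) \<and> d x = 0})"

definition total_cohomology :: "('k \<Rightarrow> 'a \<Rightarrow> 'a) \<Rightarrow> (int \<Rightarrow> 'a::ab_group_add set) \<Rightarrow> ('a \<Rightarrow> 'a)
    \<Rightarrow> int \<Rightarrow> ('k, 'a set) vspace" where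
  "total_cohomology scale P d k =
     quot (sub (whole scale) {x \<in> P k. d x = 0}) (d ` P (k - 1))"

text \<open>The image of the cohomology of \<open>(F p, d)\<close> in the cohomology of the whole complex.\<close>

definition cohomology_filtration :: "(int \<Rightarrow> 'a::ab_group_add set) \<Rightarrow> (int \<Rightarrow> 'a set) \<Rightarrow> ('a \<Rightarrow> 'a)
    \<Rightarrow> int \<Rightarrow> int \<Rightarrow> 'a set set" where
  "cohomology_filtration F P d p k = (\<lambda>x. x +o d ` P (k - 1)) ` {x \<in> F p \<inter> P k. d x = 0}"

definition Gr_cohomology :: "('k \<Rightarrow> 'a \<Rightarrow> 'a) \<Rightarrow> (int \<Rightarrow> 'a::ab_group_add set) \<Rightarrow> (int \<Rightarrow> 'a set)
    \<Rightarrow> ('a \<Rightarrow> 'a) \<Rightarrow> int \<Rightarrow> int \<Rightarrow> ('k, 'a set set) vspace" where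
  "Gr_cohomology scale F P d p k =
     quot (sub (total_cohomology scale P d k) (cohomology_filtration F P d p k))
       (cohomology_filtration F P d (p + 1) k)"

text \<open>The isomorphism is the canonical one: it sends the class of a cocycle to its class.\<close>

definition ss_converges :: "('k \<Rightarrow> 'a \<Rightarrow> 'a) \<Rightarrow> (int \<Rightarrow> 'a::ab_group_add set)
    \<Rightarrow> (int \<Rightarrow> 'a set) \<Rightarrow> ('a \<Rightarrow> 'a) \<Rightarrow> bool" where
  "ss_converges scale F P d \<longleftrightarrow>
     (\<forall>p q. \<exists>f. lin_iso (ss_E_inf scale F P d p q) (Gr_cohomology scale F P d p (p + q)) f \<and>
        (\<forall>x \<in> F p \<inter> P (p + q). d x = 0 \<longrightarrow>
           f ((x +o (F (p + 1) \<inter> P (p + q))) +o ss_B_inf scale F P d p q) =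
             (x +o d ` P (p + q - 1)) +o cohomology_filtration F P d (p + 1) (p + q)))"

end

theory Submission
  imports Defs
begin

text \<open>
  Write \<open>d\<close> for the twisted differential and \<open>F\<close> for the degree filtration. Every component
  of \<open>h\<close> has degree at least 2 and every \<open>b\<^sub>n\<close> has degree 1, so \<open>b\<^sub>n\<^sub>+\<^sub>1(h,\<dots>,h,a)\<close> lies \<open>2n + 1\<close>
  filtration steps above \<open>a\<close>. Up to \<open>F\<^sup>p\<^sup>+\<^sup>2\<^sup>N\<^sup>+\<^sup>1\<close>, therefore, \<open>d\<close> agrees on \<open>F\<^sup>p\<close> with the
  polynomial in \<open>h\<close> obtained by keeping \<open>N\<close> terms (\<open>d_approx\<close>). Since the intersection of
  all \<open>F\<^sup>p\<close> is zero (\<open>Fil_separated\<close>), an identity for \<open>d\<close> may be checked on these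
  truncations for every \<open>N\<close>: linearity and \<open>d\<^sup>2 = 0\<close> are proved in this way. For
  \<open>d\<^sup>2 = 0\<close>, the relation of the \<open>A\<^sub>\<infinity>\<close>-algebra on \<open>(h,\<dots>,h,a)\<close> carries no signs because
  \<open>h\<close> is even, and the terms in which the inner operation does not reach \<open>a\<close> add up to
  terms containing a truncation of \<open>d h = 0\<close> (\<open>sum_stasheff_h\<close>).

  That every filtered \<open>\<int>\<^sub>2\<close>-graded complex has a spectral sequence, and that this converges
  when the filtration is exhaustive and weakly convergent, is general. A page, its cohomology,
  and the graded pieces of the total cohomology are iterated quotients of subspaces of one
  vector space, so each of them is described by a pair of subspaces \<open>K\<close> and \<open>S\<close>, standing for
  \<open>S/(S \<inter> K)\<close> (\<open>presents\<close>). The isomorphisms needed are all induced by the identity on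
  representatives, and \<open>presents_lin_iso\<close> reduces them to statements about elements.

  The special features of the degree filtration are a matter of parity. If \<open>p - k\<close> is odd, an
  element of parity \<open>k\<close> in \<open>F\<^sup>p\<close> has no component in degree \<open>p\<close> and so lies in \<open>F\<^sup>p\<^sup>+\<^sup>1\<close>
  (\<open>Fil_Par_Suc\<close>). Hence the pages vanish in odd rows; for even \<open>r\<close>, source or target of
  \<open>d\<^sub>r\<close> is such a zero space; and in even rows the conditions that define cycles and boundaries
  of an even page \<open>r\<close> are those for \<open>r + 1\<close>. Finally, the lowest component of
  \<open>d x\<close> is \<open>b\<^sub>1\<close> of the lowest component of \<open>x\<close> (\<open>hcomp_d_Suc\<close>), which identifies \<open>E\<^sub>2\<close>
  with the cohomology of \<open>b\<^sub>1\<close>.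
\<close>


section \<open>Presentations of iterated quotients\<close>

locale quotient_presentations = vector_space scale
  for scale :: "'k::field \<Rightarrow> 'a::ab_group_add \<Rightarrow> 'a"
begin

text \<open>
  The space \<open>V\<close> is \<open>S/(S \<inter> K)\<close>, with \<open>\<pi>\<close> as the quotient map. Addition in a quotient is
  addition of sets, whose neutral element \<open>{0}\<close> is not the zero of the quotient, so a nested
  quotient is not a vector space in the sense of a type class. Working with representatives in
  the fixed vector space avoids the nested cosets.
\<close>

definition presents :: "('k, 'v::plus) vspace \<Rightarrow> 'a set \<Rightarrow> 'a set \<Rightarrow> ('a \<Rightarrow> 'v) \<Rightarrow> bool" where
  "presents V S K \<pi> \<longleftrightarrow>
     subspace S \<and> carrier V = \<pi> ` S \<and> vzero V = \<pi> 0 \<and>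
     (\<forall>x\<in>S. \<forall>y\<in>S. \<pi> (x + y) = \<pi> x + \<pi> y) \<and>
     (\<forall>c. \<forall>x\<in>S. \<pi> (scale c x) = smult V c (\<pi> x)) \<and>
     (\<forall>x\<in>S. \<forall>y\<in>S. \<pi> x = \<pi> y \<longleftrightarrow> x - y \<in> K)"

lemma
  assumes "presents V S K \<pi>"
  shows presents_subspace: "subspace S"
    and presents_carrier: "carrier V = \<pi> ` S"
    and presents_vzero: "vzero V = \<pi> 0"
    and presents_add: "x \<in> S \<Longrightarrow> y \<in> S \<Longrightarrow> \<pi> (x + y) = \<pi> x + \<pi> y"
    and presents_scale: "x \<in> S \<Longrightarrow> \<pi> (scale c x) = smult V c (\<pi> x)"
    and presents_eq_iff: "x \<in> S \<Longrightarrow> y \<in> S \<Longrightarrow> \<pi> x = \<pi> y \<longleftrightarrow> x - y \<in> K"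
  using assms unfolding presents_def by blast+

lemma presents_whole: "presents (whole scale) UNIV {0} (\<lambda>x. x)"
  by (simp add: presents_def whole_def)

lemma presents_sub:
  assumes "presents V S K \<pi>" "subspace S'" "S' \<subseteq> S"
  shows "presents (sub V (\<pi> ` S')) S' K \<pi>"
  using assms unfolding presents_def sub_def by (auto simp: subset_iff)

text \<open>
  Dividing by the image of a subspace \<open>T\<close> of \<open>S\<close> enlarges the kernel by \<open>T\<close> and keeps the
  representatives. This is the step that is iterated for pages and their cohomology.
\<close>

lemma presents_quot:
  fixes V :: "('k, 'v::ab_semigroup_add) vspace"
  assumes V: "presents V S K \<pi>" and T: "subspace T" "T \<subseteq> S"
  shows "presents (quot V (\<pi> ` T)) S (T + K) (\<lambda>x. \<pi> x +o \<pi> ` T)"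
proof -
  note S = presents_subspace[OF V] and add = presents_add[OF V]
    and sc = presents_scale[OF V] and eq = presents_eq_iff[OF V]
  have TS: "t \<in> T \<Longrightarrow> t \<in> S" for t using T(2) by auto
  have T0: "0 \<in> T" and S0: "0 \<in> S" using T(1) S by (auto simp: subspace_0)
  have coset: "\<pi> x +o \<pi> ` T = {\<pi> (x + t) | t. t \<in> T}" if "x \<in> S" for x
    unfolding elt_set_plus_def using add[OF that TS] by auto metis
  have le: "{\<pi> (x + t) | t. t \<in> T} \<subseteq> {\<pi> (y + t) | t. t \<in> T}"
    if "x \<in> S" "y \<in> S" and xy: "x - y \<in> T + K" for x y
  proof -
    obtain t k where tk: "t \<in> T" "k \<in> K" "x - y = t + k"
      using xy by (auto elim: set_plus_elim)
    have "\<pi> (x + t') = \<pi> (y + (t + t'))" if "t' \<in> T" for t'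
    proof -
      have "x + t' - (y + (t + t')) = k" using tk(3) by (simp add: algebra_simps)
      then show ?thesis
        using eq[of "x + t'" "y + (t + t')"] \<open>x \<in> S\<close> \<open>y \<in> S\<close> tk that
        by (simp add: S T(1) TS subspace_add)
    qed
    then show ?thesis using T(1) tk(1) subspace_add by blast
  qed
  \<comment> \<open>\<open>K\<close> is an arbitrary set, but symmetry of equality makes its part in \<open>S\<close> symmetric.\<close>
  have K0: "k \<in> K \<longleftrightarrow> - k \<in> K" if "k \<in> S" for k
    using eq[of k 0] eq[of 0 k] S0 that by auto
  show ?thesis
    unfolding presents_def
  proof (intro conjI ballI allI)
    show "subspace S" by (fact S)
    show "carrier (quot V (\<pi> ` T)) = (\<lambda>x. \<pi> x +o \<pi> ` T) ` S"
      by (simp add: quot_def presents_carrier[OF V] image_image)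
    show "vzero (quot V (\<pi> ` T)) = \<pi> 0 +o \<pi> ` T"
      by (simp add: quot_def coset[OF S0] Setcompr_eq_image)
  next
    fix x y assume xy: "x \<in> S" "y \<in> S"
    have "x + y \<in> S" using S xy by (simp add: subspace_add)
    have "\<pi> (x + y + t) = \<pi> (x + t) + \<pi> (y + 0)" "\<pi> (x + t) + \<pi> (y + t') = \<pi> (x + y + (t + t'))"
      if "t \<in> T" "t' \<in> T" for t t'
      using that xy S TS by (simp_all add: add[symmetric] subspace_add algebra_simps)
    then show "\<pi> (x + y) +o \<pi> ` T = (\<pi> x +o \<pi> ` T) + (\<pi> y +o \<pi> ` T)"
      unfolding coset[OF xy(1)] coset[OF xy(2)] coset[OF \<open>x + y \<in> S\<close>] set_plus_def
      using T0 T(1) subspace_add by blast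
  next
    fix c x assume x: "x \<in> S"
    have cx: "scale c x \<in> S" using S x by (simp add: subspace_scale)
    have *: "smult V c (\<pi> (x + t)) + \<pi> t' = \<pi> (scale c x + (scale c t + t'))"
      if "t \<in> T" "t' \<in> T" for t t'
      using that x S TS
      by (simp add: add[symmetric] sc[symmetric] subspace_add subspace_scale scale_right_distrib
          add.assoc)
    have "{\<pi> (scale c x + t) | t. t \<in> T} = smult V c ` {\<pi> (x + t) | t. t \<in> T} + \<pi> ` T"
    proof (intro equalityI subsetI)
      fix a assume "a \<in> {\<pi> (scale c x + t) | t. t \<in> T}"
      then obtain t where "t \<in> T" "a = smult V c (\<pi> (x + 0)) + \<pi> t" using *[OF T0] by auto
      then show "a \<in> smult V c ` {\<pi> (x + t) | t. t \<in> T} + \<pi> ` T"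
        using T0 by (blast intro: set_plus_intro)
    next
      fix a assume "a \<in> smult V c ` {\<pi> (x + t) | t. t \<in> T} + \<pi> ` T"
      then obtain t t' where "t \<in> T" "t' \<in> T" "a = smult V c (\<pi> (x + t)) + \<pi> t'"
        by (auto elim!: set_plus_elim)
      then show "a \<in> {\<pi> (scale c x + t) | t. t \<in> T}"
        using * subspace_add[OF T(1) subspace_scale[OF T(1)]] by blast
    qed
    then show "\<pi> (scale c x) +o \<pi> ` T = smult (quot V (\<pi> ` T)) c (\<pi> x +o \<pi> ` T)"
      by (simp add: quot_def coset[OF x] coset[OF cx])
  next
    fix x y assume xy: "x \<in> S" "y \<in> S"
    show "\<pi> x +o \<pi> ` T = \<pi> y +o \<pi> ` T \<longleftrightarrow> x - y \<in> T + K"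
    proof
      assume "\<pi> x +o \<pi> ` T = \<pi> y +o \<pi> ` T"
      then have "\<pi> (x + 0) \<in> {\<pi> (y + t) | t. t \<in> T}"
        using T0 xy coset by blast
      then obtain t where t: "t \<in> T" "\<pi> x = \<pi> (y + t)" by auto
      then have "x - (y + t) \<in> K" using eq[of x "y + t"] xy S TS by (simp add: subspace_add)
      then show "x - y \<in> T + K"
        using set_plus_intro[OF t(1), of "x - (y + t)" K] by simp
    next
      assume *: "x - y \<in> T + K"
      then obtain t k where tk: "t \<in> T" "k \<in> K" "x - y = t + k"
        by (auto elim: set_plus_elim)
      have "k = x - y - t" using tk(3) by simp
      then have "k \<in> S" using S xy TS[OF tk(1)] by (simp add: subspace_diff)
      moreover have "y - x = - t + - k" using tk(3) by (simp add: algebra_simps)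
      ultimately have "y - x \<in> T + K"
        using K0 tk T(1) by (metis set_plus_intro subspace_neg)
      then show "\<pi> x +o \<pi> ` T = \<pi> y +o \<pi> ` T"
        using le[OF xy *] le[OF xy(2,1)] coset xy by auto
    qed
  qed
qed

text \<open>
  For the differential of a page, \<open>f\<close> is already given by a definite description; it is enough
  to know its values on the classes of representatives.
\<close>

lemma presents_induced_map:
  assumes V: "presents V S K \<pi>" and V': "presents V' S' K' \<pi>'"
    and g: "\<And>x. x \<in> S \<Longrightarrow> g x \<in> S'"
    and g_add: "\<And>x y. x \<in> S \<Longrightarrow> y \<in> S \<Longrightarrow> g (x + y) = g x + g y"
    and g_scale: "\<And>c x. x \<in> S \<Longrightarrow> g (scale c x) = scale c (g x)"
    and f: "\<And>x. x \<in> S \<Longrightarrow> f (\<pi> x) = \<pi>' (g x)"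
  shows "lin_map V V' f"
proof -
  note S = presents_subspace[OF V]
  show ?thesis
    unfolding lin_map_def presents_carrier[OF V] presents_carrier[OF V']
    using S f g g_add g_scale
    by (auto simp: presents_add[OF V, symmetric] presents_add[OF V', symmetric]
        presents_scale[OF V, symmetric] presents_scale[OF V', symmetric]
        subspace_add subspace_scale)
qed

text \<open>
  With \<open>S\<close> contained in \<open>S'\<close>, the inclusion induces an isomorphism as soon as both kernels
  agree on \<open>S\<close> and \<open>S\<close> meets every class of \<open>S'\<close>.
\<close>

lemma presents_lin_iso:
  assumes V: "presents V S K \<pi>" and V': "presents V' S' K' \<pi>'"
    and sub: "S \<subseteq> S'"
    and ker: "\<And>x. x \<in> S \<Longrightarrow> x \<in> K \<longleftrightarrow> x \<in> K'"
    and onto: "\<And>y. y \<in> S' \<Longrightarrow> \<exists>x\<in>S. y - x \<in> K'"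
  shows "\<exists>f. lin_iso V V' f \<and> (\<forall>x\<in>S. f (\<pi> x) = \<pi>' x)"
proof -
  define f where "f X = \<pi>' (SOME x. x \<in> S \<and> \<pi> x = X)" for X
  note S = presents_subspace[OF V]
  have same: "\<pi> x = \<pi> y \<longleftrightarrow> \<pi>' x = \<pi>' y" if "x \<in> S" "y \<in> S" for x y
    using that sub ker[of "x - y"] S
    by (auto simp: presents_eq_iff[OF V] presents_eq_iff[OF V'] subspace_diff subset_iff)
  have f: "f (\<pi> x) = \<pi>' x" if "x \<in> S" for x
  proof -
    have "(SOME y. y \<in> S \<and> \<pi> y = \<pi> x) \<in> S \<and> \<pi> (SOME y. y \<in> S \<and> \<pi> y = \<pi> x) = \<pi> x"
      by (rule someI[of _ x]) (use that in auto)
    then show ?thesis unfolding f_def using same[OF _ that] by blast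
  qed
  have "lin_map V V' f"
    by (rule presents_induced_map[OF V V', of "\<lambda>x. x"]) (use sub f in auto)
  moreover have "inj_on f (carrier V)"
    unfolding presents_carrier[OF V] by (auto intro!: inj_onI simp: f same)
  moreover have "\<pi>' y \<in> f ` carrier V" if y: "y \<in> S'" for y
  proof -
    obtain x where "x \<in> S" "y - x \<in> K'" using onto[OF y] by blast
    then have "\<pi>' y = f (\<pi> x)" using presents_eq_iff[OF V', of y x] sub y f by auto
    then show ?thesis using \<open>x \<in> S\<close> by (auto simp: presents_carrier[OF V])
  qed
  moreover have "f ` carrier V \<subseteq> carrier V'"
    unfolding presents_carrier[OF V] presents_carrier[OF V'] using f sub by auto
  ultimately have "lin_iso V V' f"
    unfolding lin_iso_def bij_betw_def presents_carrier[OF V'] by auto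
  then show ?thesis using f by blast
qed

end


section \<open>The spectral sequence of a filtered complex\<close>

locale filtered_complex = quotient_presentations scale
  for scale :: "'k::field \<Rightarrow> 'a::ab_group_add \<Rightarrow> 'a" +
  fixes F P :: "int \<Rightarrow> 'a set" and d :: "'a \<Rightarrow> 'a"
  assumes complex: "filtered_Z2_complex scale F P d"
begin

lemma
  shows subspace_P: "subspace (P k)" and subspace_F: "subspace (F p)"
    and F_Suc: "F (p + 1) \<subseteq> F p" and d_d: "d (d x) = 0"
    and d_P: "x \<in> P k \<Longrightarrow> d x \<in> P (k + 1)"
  using complex unfolding filtered_Z2_complex_def image_subset_iff Ball_def by iprover+

lemma linear_d: "Vector_Spaces.linear scale scale d"
  using complex unfolding filtered_Z2_complex_def by iprover

lemma
  shows d_add: "d (x + y) = d x + d y" and d_diff: "d (x - y) = d x - d y"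
    and d_scale: "d (scale c x) = scale c (d x)" and d_0: "d 0 = 0"
proof -
  interpret d: Vector_Spaces.linear scale scale d by (fact linear_d)
  show "d (x + y) = d x + d y" "d (x - y) = d x - d y"
    "d (scale c x) = scale c (d x)" "d 0 = 0"
    by (fact d.add d.diff d.scale d.zero)+
qed

lemma subspace_d_image: "subspace S \<Longrightarrow> subspace (d ` S)"
proof -
  interpret d: Vector_Spaces.linear scale scale d by (fact linear_d)
  show "subspace S \<Longrightarrow> subspace (d ` S)" by (fact d.subspace_image)
qed

lemma subspace_d_into:
  assumes "subspace S" "subspace T" shows "subspace {x \<in> S. d x \<in> T}"
proof -
  interpret d: Vector_Spaces.linear scale scale d by (fact linear_d)
  have "{x \<in> S. d x \<in> T} = S \<inter> d -` T" by auto
  then show ?thesis using assms by (simp add: subspace_inter d.subspace_vimage)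
qed

lemma F_antimono:
  assumes "p \<le> p'" shows "F p' \<subseteq> F p"
proof -
  have "F (p + int n) \<subseteq> F p" for n
  proof (induction n)
    case (Suc n)
    then show ?case using F_Suc[of "p + int n"] by (auto simp: ac_simps)
  qed simp
  from this[of "nat (p' - p)"] show ?thesis using assms by simp
qed

abbreviation "FP p k \<equiv> F p \<inter> P k"
abbreviation "gr_class p k \<equiv> \<lambda>x. x +o FP (p + 1) k"

lemma subspace_FP: "subspace (FP p k)"
  by (simp add: subspace_inter subspace_F subspace_P)

lemma presents_Gr:
  "presents (Gr scale F P p k) (FP p k) (FP (p + 1) k) (gr_class p k)"
proof -
  have "FP (p + 1) k \<subseteq> FP p k" using F_Suc[of p] by auto
  from presents_quot[OF presents_sub[OF presents_whole subspace_FP subset_UNIV] subspace_FP this]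
  show ?thesis unfolding Gr_def by simp
qed

text \<open>
  The elements of the filtered complex that represent the classes in \<open>Z\<^sub>r\<close> and \<open>B\<^sub>r\<close>.
  The page \<open>E\<^sub>r\<close> is presented by \<open>Z_lift\<close> with the kernel \<open>E_kernel\<close>, the preimage of \<open>B\<^sub>r\<close>.
\<close>

definition Z_lift :: "nat \<Rightarrow> int \<Rightarrow> int \<Rightarrow> 'a set" where
  "Z_lift r p q = {x \<in> FP p (p + q). d x \<in> F (p + int r)}"

definition B_lift :: "nat \<Rightarrow> int \<Rightarrow> int \<Rightarrow> 'a set" where
  "B_lift r p q = {d y | y. y \<in> FP (p - int r + 1) (p + q - 1) \<and> d y \<in> F p}"

definition E_kernel :: "nat \<Rightarrow> int \<Rightarrow> int \<Rightarrow> 'a set" where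
  "E_kernel r p q = B_lift r p q + FP (p + 1) (p + q)"

lemma subspace_Z_lift: "subspace (Z_lift r p q)"
  unfolding Z_lift_def by (intro subspace_d_into subspace_FP subspace_F)

lemma subspace_B_lift: "subspace (B_lift r p q)"
proof -
  have "B_lift r p q = d ` {y \<in> FP (p - int r + 1) (p + q - 1). d y \<in> F p}"
    unfolding B_lift_def by auto
  moreover have "subspace {y \<in> FP (p - int r + 1) (p + q - 1). d y \<in> F p}"
    by (intro subspace_d_into subspace_FP subspace_F)
  ultimately show ?thesis using subspace_d_image by simp
qed

lemma ss_Z_eq: "ss_Z scale F P d r p q = gr_class p (p + q) ` Z_lift r p q"
  unfolding ss_Z_def Z_lift_def presents_carrier[OF presents_Gr] by auto

lemma B_lift_P: "x \<in> B_lift r p q \<Longrightarrow> x \<in> FP p (p + q)"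
  unfolding B_lift_def using d_P[of _ "p + q - 1"] by auto

lemma ss_B_eq: "ss_B scale F P d r p q = gr_class p (p + q) ` B_lift r p q"
proof -
  have "y \<in> FP (p - int r + 1) (p + q - 1) \<Longrightarrow> d y \<in> F p \<Longrightarrow> d y \<in> FP p (p + q)" for y
    using d_P[of y "p + q - 1"] by auto
  then show ?thesis
    unfolding ss_B_def B_lift_def presents_carrier[OF presents_Gr] by blast
qed

lemma B_lift_subset_Z_lift: "B_lift r p q \<subseteq> Z_lift r' p q"
  using B_lift_P[of _ r p q] subspace_0[OF subspace_F]
  by (force simp: Z_lift_def B_lift_def d_d)

lemma presents_E:
  "presents (ss_E scale F P d r p q) (Z_lift r p q) (E_kernel r p q) (ss_class scale F P d r p q)"
proof -
  have "Z_lift r p q \<subseteq> FP p (p + q)" unfolding Z_lift_def by auto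
  from presents_quot[OF presents_sub[OF presents_Gr subspace_Z_lift this]
      subspace_B_lift B_lift_subset_Z_lift, of r]
  show ?thesis
    unfolding ss_E_def ss_Z_eq ss_B_eq ss_class_def E_kernel_def by simp
qed

lemma d_Z_lift: "x \<in> Z_lift r p q \<Longrightarrow> d x \<in> Z_lift r' (p + int r) (q - int r + 1)"
  using d_P[of x "p + q"] subspace_0[OF subspace_F]
  by (auto simp: Z_lift_def d_d algebra_simps)

lemma FP_subset_E_kernel: "FP (p + 1) (p + q) \<subseteq> E_kernel r p q"
  unfolding E_kernel_def by (rule set_zero_plus2) (rule subspace_0[OF subspace_B_lift])

lemma B_lift_subset_E_kernel: "B_lift r p q \<subseteq> E_kernel r p q"
  unfolding E_kernel_def add.commute[of "B_lift r p q"]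
  by (rule set_zero_plus2) (rule subspace_0[OF subspace_FP])

text \<open>
  Two representatives of a class differ by \<open>d y + z\<close> with \<open>z\<close> one filtration step higher; then
  \<open>d\<close> of the difference is \<open>d z\<close>, and \<open>z\<close> lies exactly in the step allowed for boundaries
  of page \<open>r\<close> at the target.
\<close>

lemma d_class_unique:
  assumes x: "x \<in> Z_lift r p q" and x': "x' \<in> Z_lift r p q"
    and eq: "ss_class scale F P d r p q x = ss_class scale F P d r p q x'"
  shows "ss_class scale F P d r (p + int r) (q - int r + 1) (d x) =
    ss_class scale F P d r (p + int r) (q - int r + 1) (d x')"
proof -
  have "x - x' \<in> E_kernel r p q" using eq presents_eq_iff[OF presents_E x x'] by simp
  then obtain y z where y: "x - x' = d y + z" and z: "z \<in> FP (p + 1) (p + q)"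
    unfolding E_kernel_def B_lift_def by (auto elim!: set_plus_elim)
  have "d x - d x' = d z" using arg_cong[OF y, of d] by (simp add: d_add d_diff d_d)
  moreover have "d x - d x' \<in> F (p + int r)"
    using x x' subspace_F unfolding Z_lift_def by (auto intro: subspace_diff)
  ultimately have "d x - d x' \<in> B_lift r (p + int r) (q - int r + 1)"
    unfolding B_lift_def using z by (auto intro!: exI[of _ z] simp: algebra_simps)
  then have "d x - d x' \<in> E_kernel r (p + int r) (q - int r + 1)"
    using B_lift_subset_E_kernel by blast
  then show ?thesis
    using presents_eq_iff[OF presents_E] d_Z_lift x x' by blast
qed

lemma ss_d_class:
  assumes x: "x \<in> Z_lift r p q"
  shows "ss_d scale F P d r p q (ss_class scale F P d r p q x) =
    ss_class scale F P d r (p + int r) (q - int r + 1) (d x)"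
  unfolding ss_d_def
proof (rule the_equality)
  show "\<exists>x'\<in>FP p (p + q). d x' \<in> F (p + int r) \<and>
       ss_class scale F P d r p q x = ss_class scale F P d r p q x' \<and>
       ss_class scale F P d r (p + int r) (q - int r + 1) (d x) =
       ss_class scale F P d r (p + int r) (q - int r + 1) (d x')"
    using x unfolding Z_lift_def by auto
next
  fix \<eta> assume "\<exists>x'\<in>FP p (p + q). d x' \<in> F (p + int r) \<and>
       ss_class scale F P d r p q x = ss_class scale F P d r p q x' \<and>
       \<eta> = ss_class scale F P d r (p + int r) (q - int r + 1) (d x')"
  then show "\<eta> = ss_class scale F P d r (p + int r) (q - int r + 1) (d x)"
    using d_class_unique[OF _ x] unfolding Z_lift_def by auto
qed

lemma lin_map_ss_d:
  "lin_map (ss_E scale F P d r p q) (ss_E scale F P d r (p + int r) (q - int r + 1))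
     (ss_d scale F P d r p q)"
  by (rule presents_induced_map[OF presents_E presents_E d_Z_lift])
    (simp_all add: d_add d_scale ss_d_class)

lemma ss_d_ss_d:
  assumes "\<xi> \<in> carrier (ss_E scale F P d r p q)"
  shows "ss_d scale F P d r (p + int r) (q - int r + 1) (ss_d scale F P d r p q \<xi>) =
    vzero (ss_E scale F P d r (p + 2 * int r) (q - 2 * int r + 2))"
proof -
  obtain x where x: "x \<in> Z_lift r p q" "\<xi> = ss_class scale F P d r p q x"
    using assms unfolding presents_carrier[OF presents_E] by auto
  show ?thesis
    unfolding x(2) ss_d_class[OF x(1)] ss_d_class[OF d_Z_lift[OF x(1)]] d_d
      presents_vzero[OF presents_E] by (simp add: algebra_simps)
qed

text \<open>
  The lifts whose differentials are boundaries for page \<open>r + 1\<close> are the lifts of the cycles of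
  page \<open>r\<close> at the source of the incoming differential.
\<close>

lemma image_ss_d:
  "ss_d scale F P d r (p - int r) (q + int r - 1) `
      carrier (ss_E scale F P d r (p - int r) (q + int r - 1)) =
   ss_class scale F P d r p q ` B_lift (Suc r) p q"
proof -
  have "ss_d scale F P d r (p - int r) (q + int r - 1) `
      carrier (ss_E scale F P d r (p - int r) (q + int r - 1)) =
    ss_class scale F P d r p q ` d ` Z_lift r (p - int r) (q + int r - 1)"
    unfolding presents_carrier[OF presents_E] image_image
    by (rule image_cong) (simp_all add: ss_d_class)
  also have "d ` Z_lift r (p - int r) (q + int r - 1) = B_lift (Suc r) p q"
    unfolding B_lift_def Z_lift_def by (auto simp: algebra_simps)
  finally show ?thesis .
qed

lemma kernel_ss_d:
  "{\<xi> \<in> carrier (ss_E scale F P d r p q).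
      ss_d scale F P d r p q \<xi> = vzero (ss_E scale F P d r (p + int r) (q - int r + 1))} =
   ss_class scale F P d r p q `
     {x \<in> Z_lift r p q. d x \<in> E_kernel r (p + int r) (q - int r + 1)}"
proof -
  have "ss_d scale F P d r p q (ss_class scale F P d r p q x) =
      vzero (ss_E scale F P d r (p + int r) (q - int r + 1)) \<longleftrightarrow>
      d x \<in> E_kernel r (p + int r) (q - int r + 1)" if "x \<in> Z_lift r p q" for x
    using presents_eq_iff[OF presents_E, of "d x" r "p + int r" "q - int r + 1" 0]
      d_Z_lift[OF that] subspace_0[OF subspace_Z_lift]
    by (simp add: ss_d_class that presents_vzero[OF presents_E])
  then show ?thesis unfolding presents_carrier[OF presents_E] by auto
qed

lemma subspace_E_kernel: "subspace (E_kernel r p q)"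
proof -
  have "E_kernel r p q = {x + y | x y. x \<in> B_lift r p q \<and> y \<in> FP (p + 1) (p + q)}"
    unfolding E_kernel_def set_plus_def by blast
  then show ?thesis using subspace_sums[OF subspace_B_lift subspace_FP] by simp
qed

lemma presents_ss_cohomology:
  "presents (ss_cohomology scale F P d r p q)
     {x \<in> Z_lift r p q. d x \<in> E_kernel r (p + int r) (q - int r + 1)}
     (B_lift (Suc r) p q + E_kernel r p q)
     (\<lambda>x. ss_class scale F P d r p q x +o
        (ss_d scale F P d r (p - int r) (q + int r - 1) `
           carrier (ss_E scale F P d r (p - int r) (q + int r - 1))))"
proof -
  let ?S = "{x \<in> Z_lift r p q. d x \<in> E_kernel r (p + int r) (q - int r + 1)}"
  have S: "subspace ?S"
    by (intro subspace_d_into subspace_Z_lift subspace_E_kernel)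
  have "B_lift (Suc r) p q \<subseteq> ?S"
    using B_lift_subset_Z_lift[of "Suc r" p q r] subspace_0[OF subspace_E_kernel]
    by (auto simp: B_lift_def d_d)
  from presents_quot[OF presents_sub[OF presents_E S] subspace_B_lift this]
  show ?thesis
    unfolding ss_cohomology_def kernel_ss_d image_ss_d by auto
qed

lemma B_lift_Suc: "B_lift r p q \<subseteq> B_lift (Suc r) p q"
  using F_antimono[of "p - int r" "p - int r + 1"] unfolding B_lift_def by auto

text \<open>
  If \<open>d y\<close> represents zero in \<open>E\<^sub>r\<close>, then \<open>d y = d u + z\<close> with \<open>u\<close> one filtration step higher
  than \<open>y\<close> and \<open>z\<close> one step higher than \<open>d y\<close> needs to be. Replacing \<open>y\<close> by \<open>y - u\<close> keeps its
  class and gives a cycle for page \<open>r + 1\<close>.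
\<close>

lemma Suc_page_iso:
  "\<exists>f. lin_iso (ss_E scale F P d (Suc r) p q) (ss_cohomology scale F P d r p q) f \<and>
     (\<forall>x \<in> Z_lift (Suc r) p q.
        f (ss_class scale F P d (Suc r) p q x) =
          ss_class scale F P d r p q x +o
            (ss_d scale F P d r (p - int r) (q + int r - 1) `
               carrier (ss_E scale F P d r (p - int r) (q + int r - 1))))"
proof (rule presents_lin_iso[OF presents_E presents_ss_cohomology])
  show "Z_lift (Suc r) p q \<subseteq> {x \<in> Z_lift r p q. d x \<in> E_kernel r (p + int r) (q - int r + 1)}"
  proof
    fix x assume x: "x \<in> Z_lift (Suc r) p q"
    then have "d x \<in> FP (p + int r + 1) (p + int r + (q - int r + 1))"
      using d_P[of x "p + q"] by (auto simp: Z_lift_def algebra_simps)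
    then have "d x \<in> E_kernel r (p + int r) (q - int r + 1)"
      using FP_subset_E_kernel by blast
    moreover have "x \<in> Z_lift r p q"
      using x F_antimono[of "p + int r" "p + int (Suc r)"] by (auto simp: Z_lift_def)
    ultimately show "x \<in> {x \<in> Z_lift r p q. d x \<in> E_kernel r (p + int r) (q - int r + 1)}"
      by simp
  qed
  have "B_lift (Suc r) p q + E_kernel r p q = E_kernel (Suc r) p q"
  proof -
    have "B_lift (Suc r) p q + B_lift r p q = B_lift (Suc r) p q" (is "?B' + ?B = _")
    proof (rule antisym)
      show "?B' + ?B \<subseteq> ?B'"
        using B_lift_Suc[of r p q] subspace_add[OF subspace_B_lift]
        by (blast elim!: set_plus_elim)
      show "?B' \<subseteq> ?B' + ?B"
        unfolding add.commute[of ?B'] by (rule set_zero_plus2) (rule subspace_0[OF subspace_B_lift])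
    qed
    then show ?thesis unfolding E_kernel_def by (metis add.assoc)
  qed
  then show "x \<in> E_kernel (Suc r) p q \<longleftrightarrow> x \<in> B_lift (Suc r) p q + E_kernel r p q" for x by simp
  fix y assume y: "y \<in> {x \<in> Z_lift r p q. d x \<in> E_kernel r (p + int r) (q - int r + 1)}"
  then obtain u z where u: "u \<in> FP (p + 1) (p + q)" and z: "z \<in> F (p + int r + 1)"
    and eq: "d y = d u + z"
    unfolding E_kernel_def B_lift_def by (auto elim!: set_plus_elim simp: algebra_simps)
  have "d (y - u) = z" using eq by (simp add: d_diff)
  moreover have "y - u \<in> FP p (p + q)"
    using y u F_Suc[of p] by (intro subspace_diff subspace_FP) (auto simp: Z_lift_def)
  ultimately have "y - u \<in> Z_lift (Suc r) p q" using z by (simp add: Z_lift_def algebra_simps)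
  moreover have "y - (y - u) \<in> B_lift (Suc r) p q + E_kernel r p q"
    using u subsetD[OF set_zero_plus2[OF subspace_0[OF subspace_B_lift]] subsetD[OF FP_subset_E_kernel]]
    by simp
  ultimately show "\<exists>x\<in>Z_lift (Suc r) p q. y - x \<in> B_lift (Suc r) p q + E_kernel r p q" by blast
qed

theorem spectral_sequence: "is_spectral_sequence scale F P d"
  unfolding is_spectral_sequence_def
proof (intro allI conjI)
  fix r p q
  show "lin_map (ss_E scale F P d r p q) (ss_E scale F P d r (p + int r) (q - int r + 1))
     (ss_d scale F P d r p q)" by (fact lin_map_ss_d)
  show "\<forall>x \<in> F p \<inter> P (p + q). d x \<in> F (p + int r) \<longrightarrow>
           ss_d scale F P d r p q (ss_class scale F P d r p q x) =
             ss_class scale F P d r (p + int r) (q - int r + 1) (d x)"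
    using ss_d_class unfolding Z_lift_def by auto
  show "\<forall>\<xi> \<in> carrier (ss_E scale F P d r p q).
           ss_d scale F P d r (p + int r) (q - int r + 1) (ss_d scale F P d r p q \<xi>) =
             vzero (ss_E scale F P d r (p + 2 * int r) (q - 2 * int r + 2))"
    using ss_d_ss_d by blast
  show "\<exists>f. lin_iso (ss_E scale F P d (Suc r) p q) (ss_cohomology scale F P d r p q) f \<and>
           (\<forall>x \<in> F p \<inter> P (p + q). d x \<in> F (p + int (Suc r)) \<longrightarrow>
              f (ss_class scale F P d (Suc r) p q x) =
                ss_class scale F P d r p q x +o
                  (ss_d scale F P d r (p - int r) (q + int r - 1) `
                    carrier (ss_E scale F P d r (p - int r) (q + int r - 1))))"
    using Suc_page_iso[of r p q] by (simp add: Z_lift_def Ball_def imp_conjL)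
qed


definition cocycles :: "int \<Rightarrow> int \<Rightarrow> 'a set" where
  "cocycles p k = {x \<in> FP p k. d x = 0}"

lemma subspace_cocycles: "subspace (cocycles p k)"
  using subspace_d_into[OF subspace_FP subspace_single_0] unfolding cocycles_def by simp

lemma presents_Gr_cohomology:
  "presents (Gr_cohomology scale F P d p k) (cocycles p k) (cocycles (p + 1) k + d ` P (k - 1))
     (\<lambda>x. (x +o d ` P (k - 1)) +o cohomology_filtration F P d (p + 1) k)"
proof -
  have S: "subspace {x \<in> P k. d x = 0}"
    using subspace_d_into[OF subspace_P subspace_single_0] by simp
  have "d ` P (k - 1) \<subseteq> {x \<in> P k. d x = 0}" using d_P[of _ "k - 1"] by (auto simp: d_d)
  from presents_quot[OF presents_sub[OF presents_whole S] subspace_d_image[OF subspace_P] this]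
  have H: "presents (total_cohomology scale P d k) {x \<in> P k. d x = 0} (d ` P (k - 1))
      (\<lambda>x. x +o d ` P (k - 1))"
    unfolding total_cohomology_def by simp
  have "cocycles p k \<subseteq> {x \<in> P k. d x = 0}" "cocycles (p + 1) k \<subseteq> cocycles p k"
    using F_Suc unfolding cocycles_def by auto
  from presents_quot[OF presents_sub[OF H subspace_cocycles this(1)] subspace_cocycles this(2)]
  show ?thesis
    unfolding Gr_cohomology_def cohomology_filtration_def by (simp add: cocycles_def)
qed

text \<open>
  Because the filtration is exhaustive, an element whose differential lies in \<open>F p\<close> counts for
  \<open>B\<^sub>r\<close> once \<open>r\<close> is large.
\<close>

lemma Union_B_lift:
  assumes "exhaustive F"
  shows "(\<Union>r. B_lift r p q) = F p \<inter> d ` P (p + q - 1)"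
proof (intro equalityI subsetI)
  fix x assume "x \<in> F p \<inter> d ` P (p + q - 1)"
  then obtain y where y: "y \<in> P (p + q - 1)" "x = d y" "d y \<in> F p" by auto
  obtain s where "y \<in> F s" using assms unfolding exhaustive_def by auto
  moreover have "p - int (nat (p - s + 1)) + 1 \<le> s" by simp
  ultimately have "y \<in> F (p - int (nat (p - s + 1)) + 1)"
    using F_antimono by blast
  then show "x \<in> (\<Union>r. B_lift r p q)" unfolding B_lift_def using y by blast
qed (auto simp: B_lift_def)

lemma presents_E_inf:
  assumes "exhaustive F" and "weakly_convergent scale F P d"
  shows "presents (ss_E_inf scale F P d p q) (cocycles p (p + q))
     (F p \<inter> d ` P (p + q - 1) + FP (p + 1) (p + q))
     (\<lambda>x. gr_class p (p + q) x +o ss_B_inf scale F P d p q)"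
proof -
  have Z: "ss_Z_inf scale F P d p q = gr_class p (p + q) ` cocycles p (p + q)"
    using assms(2) unfolding weakly_convergent_def cocycles_def presents_carrier[OF presents_Gr]
    by auto
  have B: "ss_B_inf scale F P d p q = gr_class p (p + q) ` (F p \<inter> d ` P (p + q - 1))"
    unfolding ss_B_inf_def ss_B_eq Union_B_lift[OF assms(1), symmetric] by auto
  have "cocycles p (p + q) \<subseteq> FP p (p + q)" unfolding cocycles_def by auto
  moreover have "F p \<inter> d ` P (p + q - 1) \<subseteq> cocycles p (p + q)"
    using d_P[of _ "p + q - 1"] unfolding cocycles_def by (auto simp: d_d)
  ultimately show ?thesis
    unfolding ss_E_inf_def Z B
    by (intro presents_quot presents_sub[OF presents_Gr] subspace_cocycles subspace_inter
        subspace_F subspace_d_image subspace_P)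
qed

text \<open>
  By weak convergence both sides are quotients of the space of cocycles in \<open>F p\<close>. The two kernels
  agree: if a cocycle \<open>x\<close> in \<open>F p\<close> is \<open>d y + z\<close> with \<open>z\<close> in \<open>F (p + 1)\<close>, then \<open>z = x - d y\<close> is a cocycle
  and \<open>d y = x - z\<close> lies in \<open>F p\<close>.
\<close>

theorem convergence:
  assumes "exhaustive F" and "weakly_convergent scale F P d"
  shows "ss_converges scale F P d"
  unfolding ss_converges_def
proof (intro allI)
  fix p q
  let ?K = "F p \<inter> d ` P (p + q - 1) + FP (p + 1) (p + q)"
  let ?K' = "cocycles (p + 1) (p + q) + d ` P (p + q - 1)"
  have ker: "x \<in> ?K \<longleftrightarrow> x \<in> ?K'" if x: "x \<in> cocycles p (p + q)" for x
  proof
    assume "x \<in> ?K"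
    then obtain y z where yz: "y \<in> P (p + q - 1)" "z \<in> FP (p + 1) (p + q)" "x = d y + z"
      by (auto elim!: set_plus_elim)
    have "d z = d x - d (d y)" by (simp add: yz(3) d_add)
    then have "z \<in> cocycles (p + 1) (p + q)" using x yz(2) by (simp add: cocycles_def d_d)
    then show "x \<in> ?K'" using yz by (metis add.commute imageI set_plus_intro)
  next
    assume "x \<in> ?K'"
    then obtain y z where yz: "y \<in> P (p + q - 1)" "z \<in> cocycles (p + 1) (p + q)" "x = z + d y"
      by (auto elim!: set_plus_elim)
    have "d y = x - z" by (simp add: yz(3))
    moreover have "x \<in> F p" "z \<in> F p" using x yz(2) F_Suc by (auto simp: cocycles_def)
    ultimately have "d y \<in> F p" using subspace_diff[OF subspace_F] by simp
    then show "x \<in> ?K"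
      using yz by (auto simp: cocycles_def add.commute[of z] intro!: set_plus_intro)
  qed
  have onto: "\<exists>x\<in>cocycles p (p + q). y - x \<in> ?K'" if "y \<in> cocycles p (p + q)" for y
    using that set_plus_intro[OF subspace_0[OF subspace_cocycles]
        subspace_0[OF subspace_d_image[OF subspace_P]], of "p + 1" "p + q" "p + q - 1"]
    by (intro bexI[of _ y]) auto
  from presents_lin_iso[OF presents_E_inf[OF assms] presents_Gr_cohomology subset_refl ker onto]
  show "\<exists>f. lin_iso (ss_E_inf scale F P d p q) (Gr_cohomology scale F P d p (p + q)) f \<and>
        (\<forall>x \<in> F p \<inter> P (p + q). d x = 0 \<longrightarrow>
           f ((x +o (F (p + 1) \<inter> P (p + q))) +o ss_B_inf scale F P d p q) =
             (x +o d ` P (p + q - 1)) +o cohomology_filtration F P d (p + 1) (p + q))"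
    by (simp add: cocycles_def Ball_def imp_conjL)
qed

end


section \<open>Homogeneous components\<close>

context graded_vector_space
begin

lemma decomposition_hcomp: "decomposition A a (\<lambda>k. hcomp A k a)"
  using theI'[OF unique_decomposition] unfolding hcomp_def by simp

lemma
  shows hcomp_in: "hcomp A k a \<in> A k"
    and finite_hcomp: "finite {k. hcomp A k a \<noteq> 0}"
    and sum_hcomp: "(\<Sum>k | hcomp A k a \<noteq> 0. hcomp A k a) = a"
  using decomposition_hcomp[of a] unfolding decomposition_def by metis+

lemma hcomp_unique:
  assumes "decomposition A a f" shows "hcomp A k a = f k"
proof -
  have "(THE g. decomposition A a g) = f"
    by (rule the1_equality) (fact unique_decomposition assms)+
  then show ?thesis unfolding hcomp_def by (rule fun_cong)
qed

lemma hcomp_eqI: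
  assumes "\<And>k. hcomp A k x = hcomp A k y" shows "x = y"
proof -
  have "(\<Sum>k | hcomp A k x \<noteq> 0. hcomp A k x) = (\<Sum>k | hcomp A k y \<noteq> 0. hcomp A k y)"
    by (simp only: assms)
  then show ?thesis by (simp only: sum_hcomp)
qed

lemma hcomp_sum_components:
  assumes "finite I" and "\<And>k. f k \<in> A k" and "\<And>k. k \<notin> I \<Longrightarrow> f k = 0"
  shows "hcomp A k (sum f I) = f k"
proof (rule hcomp_unique)
  have "{k. f k \<noteq> 0} \<subseteq> I" using assms(3) by auto
  moreover from this have "sum f I = (\<Sum>k | f k \<noteq> 0. f k)"
    using assms(1) by (intro sum.mono_neutral_right) auto
  ultimately show "decomposition A (sum f I) f"
    using assms finite_subset unfolding decomposition_def by auto
qed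

lemma hcomp_add: "hcomp A k (x + y) = hcomp A k x + hcomp A k y"
proof -
  let ?I = "{k. hcomp A k x \<noteq> 0} \<union> {k. hcomp A k y \<noteq> 0}"
  have sums: "(\<Sum>k\<in>?I. hcomp A k z) = z" if "z \<in> {x, y}" for z
  proof -
    have "(\<Sum>k\<in>?I. hcomp A k z) = (\<Sum>k | hcomp A k z \<noteq> 0. hcomp A k z)"
      by (rule sum.mono_neutral_right) (use that finite_hcomp in auto)
    then show ?thesis by (simp add: sum_hcomp)
  qed
  have "hcomp A k (\<Sum>k\<in>?I. hcomp A k x + hcomp A k y) = hcomp A k x + hcomp A k y"
    by (rule hcomp_sum_components)
      (auto simp: finite_hcomp subspace_add[OF subspace_component hcomp_in hcomp_in])
  then show ?thesis using sums by (simp add: sum.distrib)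
qed

lemma hcomp_scale: "hcomp A k (scale c x) = scale c (hcomp A k x)"
proof -
  have "hcomp A k (\<Sum>k | hcomp A k x \<noteq> 0. scale c (hcomp A k x)) = scale c (hcomp A k x)"
    by (rule hcomp_sum_components)
      (auto simp: finite_hcomp subspace_scale[OF subspace_component hcomp_in])
  then show ?thesis by (simp add: scale_sum_right[symmetric] sum_hcomp)
qed

lemma linear_hcomp: "Vector_Spaces.linear scale scale (hcomp A k)"
  by (simp add: Vector_Spaces.linear_iff vector_space_axioms hcomp_add hcomp_scale)

lemma
  shows hcomp_0: "hcomp A k 0 = 0"
    and hcomp_diff: "hcomp A k (x - y) = hcomp A k x - hcomp A k y"
    and hcomp_sum: "hcomp A k (sum f I) = (\<Sum>i\<in>I. hcomp A k (f i))"
proof -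
  interpret c: Vector_Spaces.linear scale scale "hcomp A k" by (fact linear_hcomp)
  show "hcomp A k 0 = 0" "hcomp A k (x - y) = hcomp A k x - hcomp A k y"
    "hcomp A k (sum f I) = (\<Sum>i\<in>I. hcomp A k (f i))"
    by (fact c.zero c.diff c.sum)+
qed

lemma hcomp_homogeneous:
  assumes "x \<in> A j" shows "hcomp A k x = (if k = j then x else 0)"
  using hcomp_sum_components[of "{j}" "\<lambda>i. if i = j then x else 0" k] assms
    subspace_0[OF subspace_component] by auto

lemma subspace_dsum: "subspace (dsum_over scale A I)"
  unfolding dsum_over_def by (rule subspace_span)

text \<open>
  Membership in a partial sum of components is tested on components. From here on, inclusions
  between filtration steps and parity parts are statements about index sets.
\<close>

lemma dsum_iff: "x \<in> dsum_over scale A I \<longleftrightarrow> (\<forall>k. k \<notin> I \<longrightarrow> hcomp A k x = 0)"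
proof
  have "subspace {x. \<forall>k. k \<notin> I \<longrightarrow> hcomp A k x = 0}"
    unfolding subspace_def by (auto simp: hcomp_0 hcomp_add hcomp_scale)
  moreover have "(\<Union>n\<in>I. A n) \<subseteq> {x. \<forall>k. k \<notin> I \<longrightarrow> hcomp A k x = 0}"
    by (auto simp: hcomp_homogeneous)
  ultimately show "x \<in> dsum_over scale A I \<Longrightarrow> \<forall>k. k \<notin> I \<longrightarrow> hcomp A k x = 0"
    unfolding dsum_over_def using span_minimal by blast
next
  assume *: "\<forall>k. k \<notin> I \<longrightarrow> hcomp A k x = 0"
  have "(\<Sum>k | hcomp A k x \<noteq> 0. hcomp A k x) \<in> dsum_over scale A I"
    by (rule subspace_sum[OF subspace_dsum])
      (use * hcomp_in in \<open>auto simp: dsum_over_def intro!: span_base\<close>)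
  then show "x \<in> dsum_over scale A I" by (simp add: sum_hcomp)
qed

lemma dsum_Int: "dsum_over scale A I \<inter> dsum_over scale A J = dsum_over scale A (I \<inter> J)"
  by (auto simp: dsum_iff)

lemma dsum_mono: "I \<subseteq> J \<Longrightarrow> dsum_over scale A I \<subseteq> dsum_over scale A J"
  by (force simp: dsum_iff)

lemma homogeneous_in_dsum: "x \<in> A k \<Longrightarrow> k \<in> I \<Longrightarrow> x \<in> dsum_over scale A I"
  by (auto simp: dsum_iff hcomp_homogeneous)

lemma dsum_split:
  assumes "x \<in> dsum_over scale A (I \<union> J)"
  shows "x \<in> dsum_over scale A I + dsum_over scale A J"
proof -
  define y where "y = (\<Sum>k | hcomp A k x \<noteq> 0. if k \<in> I then hcomp A k x else 0)"
  have y: "hcomp A k y = (if k \<in> I then hcomp A k x else 0)" for k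
    unfolding y_def
    by (rule hcomp_sum_components)
      (auto simp: finite_hcomp hcomp_in subspace_0[OF subspace_component])
  have "y \<in> dsum_over scale A I" "x - y \<in> dsum_over scale A J"
    using assms by (auto simp: dsum_iff y hcomp_diff)
  from set_plus_intro[OF this] show ?thesis by simp
qed

abbreviation "Fil \<equiv> degree_filtration scale A"
abbreviation "Par \<equiv> parity_part scale A"

lemma Fil_iff: "x \<in> Fil p \<longleftrightarrow> (\<forall>k<p. hcomp A k x = 0)"
  by (auto simp: degree_filtration_def dsum_iff)

lemma Par_iff: "x \<in> Par k \<longleftrightarrow> (\<forall>j. odd (j - k) \<longrightarrow> hcomp A j x = 0)"
proof -
  have "j mod 2 \<noteq> k mod 2 \<longleftrightarrow> odd (j - k)" for j by presburger
  then show ?thesis by (auto simp: parity_part_def dsum_iff)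
qed

lemma subspace_Fil: "subspace (Fil p)" and subspace_Par: "subspace (Par k)"
  unfolding degree_filtration_def parity_part_def by (fact subspace_dsum)+

lemma Fil_antimono: "p \<le> p' \<Longrightarrow> x \<in> Fil p' \<Longrightarrow> x \<in> Fil p"
  by (auto simp: Fil_iff)

text \<open>
  The source of all the degeneration results: graded pieces of the wrong parity vanish.
\<close>

lemma Fil_Par_Suc: "odd (p - k) \<Longrightarrow> Fil (p + 1) \<inter> Par k = Fil p \<inter> Par k"
proof (intro equalityI subsetI)
  fix x assume odd: "odd (p - k)" and x: "x \<in> Fil p \<inter> Par k"
  have "hcomp A j x = 0" if "j < p + 1" for j
    using that x odd by (cases "j = p") (auto simp: Fil_iff Par_iff)
  then show "x \<in> Fil (p + 1) \<inter> Par k" using x by (auto simp: Fil_iff)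
qed (auto simp: Fil_iff)

lemma exhaustive_Fil: "exhaustive Fil"
proof -
  have "\<exists>p. x \<in> Fil p" for x
  proof -
    have "bdd_below {k. hcomp A k x \<noteq> 0}" using finite_hcomp by (rule bdd_below_finite)
    then obtain p where "\<forall>k\<in>{k. hcomp A k x \<noteq> 0}. p \<le> k"
      unfolding bdd_below.unfold by blast
    then have "x \<in> Fil p" unfolding Fil_iff by (metis mem_Collect_eq not_le)
    then show ?thesis by blast
  qed
  then show ?thesis unfolding exhaustive_def by auto
qed

lemma Fil_separated:
  assumes "\<And>N. x \<in> Fil (p + 2 * int N + 1)" shows "x = 0"
proof (rule hcomp_eqI)
  fix k
  have "k < p + 2 * int (nat (k - p)) + 1" by simp
  then show "hcomp A k x = hcomp A k 0" using assms[of "nat (k - p)"] by (auto simp: Fil_iff hcomp_0)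
qed

end


section \<open>Multilinearity\<close>

context graded_vector_space
begin

text \<open>
  A property that is closed under linear combinations in each slot of a list extends from
  generators to spans, one slot after the other. The degree conditions and the relation of an
  \<open>A\<^sub>\<infinity>\<close>-algebra are given for homogeneous arguments; \<open>h\<close> and the argument of the
  twisted differential are in general not homogeneous.
\<close>

lemma multilinear_span_induct:
  assumes base: "\<And>xs. list_all2 (\<in>) xs Ss \<Longrightarrow> Q xs"
    and slot: "\<And>us vs. subspace {x. Q (us @ x # vs)}"
    and xs: "list_all2 (\<lambda>x S. x \<in> span S) xs Ss"
  shows "Q xs"
proof -
  \<comment> \<open>The slots in \<open>us\<close> have been extended to spans; those in \<open>vs\<close> still hold generators.\<close>
  have "Q (us @ vs)"
    if "list_all2 (\<lambda>x S. x \<in> span S) us Ss'" "list_all2 (\<in>) vs Ts" "Ss = Ss' @ Ts" for us Ss' vs Ts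
    using that
  proof (induction us arbitrary: Ss' vs Ts rule: rev_induct)
    case Nil
    then show ?case using base by simp
  next
    case (snoc x us)
    then obtain Us S where S: "Ss' = Us @ [S]" "list_all2 (\<lambda>x S. x \<in> span S) us Us" "x \<in> span S"
      by (auto simp: list_all2_append1 list_all2_Cons1)
    have "S \<subseteq> {x. Q (us @ x # vs)}"
      using snoc.IH[OF S(2), of _ "S # Ts"] snoc.prems S(1) by auto
    then have "span S \<subseteq> {x. Q (us @ x # vs)}" using slot by (rule span_minimal)
    then show ?case using S(3) by auto
  qed
  from this[OF xs, of "[]" "[]"] show ?thesis by simp
qed

end

context ainfty_algebra
begin

lemma linear_b_slot: "Vector_Spaces.linear scale scale (\<lambda>x. b (us @ x # vs))"
  by (simp add: Vector_Spaces.linear_iff vector_space_axioms b_add b_scale)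

lemma homogeneous_degrees:
  assumes "list_all2 (\<in>) xs (map (\<lambda>I. \<Union>n\<in>I. A n) Is)"
  obtains ks where "list_all2 (\<lambda>x k. x \<in> A k) xs ks" "list_all2 (\<in>) ks Is"
proof -
  have "list_all2 ((\<lambda>x k. x \<in> A k) OO (\<in>)) xs Is"
    using assms unfolding list_all2_map2 by (rule list_all2_mono) auto
  then show ?thesis using that unfolding list.rel_compp by auto
qed

lemma b_dsum:
  assumes xs: "list_all2 (\<lambda>x I. x \<in> dsum_over scale A I) xs Is" "xs \<noteq> []"
    and J: "\<And>ks. list_all2 (\<in>) ks Is \<Longrightarrow> sum_list ks + 1 \<in> J"
  shows "b xs \<in> dsum_over scale A J"
proof (rule multilinear_span_induct[of "map (\<lambda>I. \<Union>n\<in>I. A n) Is"])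
  fix ys assume ys: "list_all2 (\<in>) ys (map (\<lambda>I. \<Union>n\<in>I. A n) Is)"
  then obtain ks where "list_all2 (\<lambda>x k. x \<in> A k) ys ks" "list_all2 (\<in>) ks Is"
    by (rule homogeneous_degrees)
  moreover have "ys \<noteq> []" using ys xs list_all2_lengthD by fastforce
  ultimately show "b ys \<in> dsum_over scale A J"
    using b_degree J homogeneous_in_dsum by blast
next
  fix us vs
  interpret l: Vector_Spaces.linear scale scale "\<lambda>x. b (us @ x # vs)" by (fact linear_b_slot)
  show "subspace {x. b (us @ x # vs) \<in> dsum_over scale A J}"
    using l.subspace_vimage[OF subspace_dsum] by (simp add: vimage_def)
next
  show "list_all2 (\<lambda>x S. x \<in> span S) xs (map (\<lambda>I. \<Union>n\<in>I. A n) Is)"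
    using xs(1) by (simp add: list_all2_map2 dsum_over_def)
qed

lemma b_Fil:
  assumes "list_all2 (\<lambda>x p. x \<in> Fil p) xs ps" "xs \<noteq> []"
  shows "b xs \<in> Fil (sum_list ps + 1)"
proof -
  have "sum_list ps \<le> sum_list ks" if "list_all2 (\<in>) ks (map atLeast ps)" for ks :: "int list"
    using that by (induction ks arbitrary: ps) (auto simp: list_all2_Cons1 intro!: add_mono)
  then show ?thesis
    unfolding degree_filtration_def using assms
    by (intro b_dsum[of _ "map atLeast ps"]) (auto simp: list_all2_map2 degree_filtration_def)
qed

lemma b_Par:
  assumes "list_all2 (\<lambda>x k. x \<in> Par k) xs ks" "xs \<noteq> []"
  shows "b xs \<in> Par (sum_list ks + 1)"
proof -
  have "sum_list js mod 2 = sum_list ks mod 2"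
    if "list_all2 (\<in>) js (map (\<lambda>k. {n. n mod 2 = k mod 2}) ks)" for js :: "int list"
    using that by (induction js arbitrary: ks) (auto simp: list_all2_Cons1 intro!: mod_add_cong)
  then show ?thesis
    unfolding parity_part_def using assms
    by (intro b_dsum[of _ "map (\<lambda>k. {n. n mod 2 = k mod 2}) ks"])
      (auto simp: list_all2_map2 parity_part_def intro: mod_add_cong)
qed

text \<open>
  One summand of the \<open>A\<^sub>\<infinity>\<close>-relation, without its sign.
\<close>

definition stasheff_term :: "nat \<Rightarrow> nat \<Rightarrow> 'a list \<Rightarrow> 'a" where
  "stasheff_term r s xs = b (take r xs @ b (take s (drop r xs)) # drop (r + s) xs)"

text \<open>
  The slot lies before, inside or after the block on which the inner operation acts.
\<close>

lemma linear_stasheff_slot: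
  "Vector_Spaces.linear scale scale (\<lambda>x. stasheff_term r s (us @ x # vs))"
proof -
  let ?i = "length us"
  have lin: "Vector_Spaces.linear scale scale (\<lambda>x. b (us' @ b (us'' @ x # vs'') # vs'))"
    for us' us'' vs'' vs'
    by (simp add: Vector_Spaces.linear_iff vector_space_axioms b_add b_scale)
  consider "?i < r" | "r \<le> ?i" "?i < r + s" | "r + s \<le> ?i" by linarith
  then show ?thesis
  proof cases
    case 1
    then have "stasheff_term r s (us @ x # vs) = b (us @ x # take (r - ?i - 1) vs
        @ b (take s (drop (r - ?i - 1) vs)) # drop (r + s - ?i - 1) vs)" for x
      by (simp add: stasheff_term_def take_Cons' drop_Cons')
    then show ?thesis using linear_b_slot by simp
  next
    case 2
    then have "stasheff_term r s (us @ x # vs) = b (take r us @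
        b (drop r us @ x # take (s - (?i - r) - 1) vs) # drop (r + s - ?i - 1) vs)" for x
      by (simp add: stasheff_term_def take_Cons' drop_Cons')
    then show ?thesis using lin by simp
  next
    case 3
    then have "stasheff_term r s (us @ x # vs) = b ((take r us @
        b (take s (drop r us)) # drop (r + s) us) @ x # vs)" for x
      by (simp add: stasheff_term_def)
    then show ?thesis using linear_b_slot by presburger
  qed
qed

lemma finite_splittings: "finite {(r, s, t). s \<ge> 1 \<and> r + s + t = (n::nat)}"
  by (rule finite_subset[of _ "{..n} \<times> {..n} \<times> {..n}"]) auto

text \<open>
  The inner operation starts at position \<open>r \<le> n\<close>, hence only passes copies of the even element
  \<open>h\<close>, and the sign of each summand is 1.
\<close>

lemma even_relation:
  assumes "h \<in> Par 0"
  shows "(\<Sum>(r, s, t)\<in>{(r, s, t). s \<ge> 1 \<and> r + s + t = Suc n}.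
    stasheff_term r s (replicate n h @ [a])) = 0"
proof -
  let ?J = "{(r, s, t::nat). s \<ge> 1 \<and> r + s + t = Suc n}"
  let ?E = "{k. k mod 2 = 0 mod 2} :: int set"
  let ?Is = "replicate n ?E @ [UNIV]"
  define Q where "Q xs \<longleftrightarrow> (\<Sum>(r, s, t)\<in>?J. stasheff_term r s xs) = 0" for xs
  have "Q (replicate n h @ [a])"
  proof (rule multilinear_span_induct[of "map (\<lambda>I. \<Union>n\<in>I. A n) ?Is"])
    fix xs assume "list_all2 (\<in>) xs (map (\<lambda>I. \<Union>n\<in>I. A n) ?Is)"
    then obtain js where js: "list_all2 (\<lambda>x k. x \<in> A k) xs js" "list_all2 (\<in>) js ?Is"
      by (rule homogeneous_degrees)
    then obtain ks k where ks: "js = ks @ [k]" "list_all2 (\<in>) ks (replicate n ?E)"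
      by (auto simp: list_all2_append2 list_all2_Cons2)
    have len: "length xs = Suc n" "length ks = n"
      using js ks by (auto dest!: list_all2_lengthD)
    have "even (sum_list (take r ks))" for r
    proof -
      have "\<forall>k\<in>set ks. even k"
        using ks(2) by (auto simp: list_all2_conv_all_nth in_set_conv_nth)
      then have "\<forall>k\<in>set (take r ks). even k" by (auto dest: in_set_takeD)
      moreover have "(\<forall>k\<in>set l. even k) \<Longrightarrow> even (sum_list l)" for l :: "int list"
        by (induction l) auto
      ultimately show ?thesis by blast
    qed
    then have sign: "(-1) powi sum_list (take r (ks @ [k])) = (1::'k)" if "r \<le> n" for r
      using that len by simp
    have "xs \<noteq> []" using len by auto
    from b_relation[OF this js(1)]
    have "(\<Sum>(r, s, t)\<in>?J. scale ((-1) powi sum_list (take r (ks @ [k])))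
        (stasheff_term r s xs)) = 0"
      using len by (simp add: stasheff_term_def ks(1))
    also have "(\<Sum>(r, s, t)\<in>?J. scale ((-1) powi sum_list (take r (ks @ [k])))
        (stasheff_term r s xs)) = (\<Sum>(r, s, t)\<in>?J. stasheff_term r s xs)"
      by (rule sum.cong) (auto simp: sign simp del: take_append)
    finally show "Q xs" unfolding Q_def .
  next
    fix us vs
    have "stasheff_term r s (us @ (x + y) # vs) =
        stasheff_term r s (us @ x # vs) + stasheff_term r s (us @ y # vs)"
      "stasheff_term r s (us @ scale c x # vs) = scale c (stasheff_term r s (us @ x # vs))"
      for r s x y c
      using linear_stasheff_slot[of r s us vs] unfolding Vector_Spaces.linear_iff by blast+
    then have "Vector_Spaces.linear scale scale
        (\<lambda>x. \<Sum>(r, s, t)\<in>?J. stasheff_term r s (us @ x # vs))"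
      by (simp add: Vector_Spaces.linear_iff vector_space_axioms sum.distrib scale_sum_right
          case_prod_unfold)
    then interpret l: Vector_Spaces.linear scale scale
      "\<lambda>x. \<Sum>(r, s, t)\<in>?J. stasheff_term r s (us @ x # vs)" .
    show "subspace {x. Q (us @ x # vs)}"
      using l.subspace_vimage[OF subspace_single_0] by (simp add: vimage_def Q_def)
  next
    have "h \<in> span (\<Union>k\<in>?E. A k)" using assms unfolding parity_part_def dsum_over_def .
    moreover have "a \<in> span (\<Union>k. A k)"
      using dsum_iff[of a UNIV] unfolding dsum_over_def by simp
    ultimately show "list_all2 (\<lambda>x S. x \<in> span S) (replicate n h @ [a])
        (map (\<lambda>I. \<Union>n\<in>I. A n) ?Is)"
      unfolding map_append by (intro list_all2_appendI) (auto simp: list_all2_conv_all_nth)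
  qed
  then show ?thesis unfolding Q_def .
qed

lemma b_b: "b [b [a]] = 0"
proof -
  have "{(r, s, t). s \<ge> 1 \<and> r + s + t = Suc 0} = {(0, 1, 0)}" by auto
  then show ?thesis
    using even_relation[OF subspace_0[OF subspace_Par], of 0 a] by (simp add: stasheff_term_def)
qed

end


section \<open>The twisted differential\<close>

locale positively_twisted = ainfty_algebra scale A b
  for scale :: "'k::field \<Rightarrow> 'a::ab_group_add \<Rightarrow> 'a" and A :: "int \<Rightarrow> 'a set"
    and b :: "'a list \<Rightarrow> 'a" +
  fixes h :: 'a
  assumes twisting: "twisting_element scale A b h"
    and positive: "positive_degree scale A h"
begin

abbreviation "d \<equiv> twist_diff A b h"
abbreviation "twist n a \<equiv> twist_term b h a n"

text \<open>
  The differential \<open>d\<close> is an infinite series, summed in each degree separately; its truncations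
  are finite sums, to which multilinearity and the relations of the algebra apply.
\<close>

definition truncation :: "nat \<Rightarrow> 'a \<Rightarrow> 'a" where
  "truncation N a = (\<Sum>n<N. twist n a)"

lemma h_Par: "h \<in> Par 0" and h_Fil: "h \<in> Fil 2"
proof -
  have "{2 * i | i. i \<ge> 1} \<subseteq> {n :: int. n mod 2 = 0 mod 2}" "{2 * i | i. i \<ge> 1} \<subseteq> {2 :: int..}"
    by auto
  then show "h \<in> Par 0" "h \<in> Fil 2"
    using positive dsum_mono
    unfolding positive_degree_def parity_part_def degree_filtration_def by blast+
qed

lemma twist_Fil:
  assumes "a \<in> Fil p" shows "twist n a \<in> Fil (p + 2 * int n + 1)"
proof -
  have "list_all2 (\<lambda>x p. x \<in> Fil p) (replicate n h @ [a]) (replicate n 2 @ [p])"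
    using h_Fil assms by (intro list_all2_appendI) (auto simp: list_all2_conv_all_nth)
  from b_Fil[OF this] show ?thesis
    by (simp add: twist_term_def sum_list_replicate algebra_simps)
qed

lemma twist_Par:
  assumes "a \<in> Par k" shows "twist n a \<in> Par (k + 1)"
proof -
  have "list_all2 (\<lambda>x k. x \<in> Par k) (replicate n h @ [a]) (replicate n 0 @ [k])"
    using h_Par assms by (intro list_all2_appendI) (auto simp: list_all2_conv_all_nth)
  from b_Par[OF this] show ?thesis by (simp add: twist_term_def sum_list_replicate)
qed

lemma formal_sums_d: "formal_sums A (twist_term b h a) (d a)"
proof -
  obtain y where y: "formal_sums A (twist_term b h a) y"
    using twisting unfolding twisting_element_def twist_defined_def by blast
  have "z = y" if "formal_sums A (twist_term b h a) z" for z
  proof (rule hcomp_eqI)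
    fix k show "hcomp A k z = hcomp A k y"
      using that y unfolding formal_sums_def by metis
  qed
  then show ?thesis unfolding twist_diff_def using y by (rule theI[rotated])
qed

lemma hcomp_d: "hcomp A k (d a) = (\<Sum>n | hcomp A k (twist n a) \<noteq> 0. hcomp A k (twist n a))"
  using formal_sums_d unfolding formal_sums_def by blast

lemma d_approx:
  assumes "a \<in> Fil p" shows "d a - truncation N a \<in> Fil (p + 2 * int N + 1)"
  unfolding Fil_iff
proof (intro allI impI)
  fix k assume k: "k < p + 2 * int N + 1"
  have "hcomp A k (twist n a) = 0" if "N \<le> n" for n
    using twist_Fil[OF assms, of n] k that unfolding Fil_iff by auto
  then have "{n. hcomp A k (twist n a) \<noteq> 0} \<subseteq> {..<N}" by (auto simp: not_le[symmetric])
  then have "hcomp A k (d a) = (\<Sum>n<N. hcomp A k (twist n a))"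
    unfolding hcomp_d by (intro sum.mono_neutral_left) auto
  then show "hcomp A k (d a - truncation N a) = 0"
    by (simp add: truncation_def hcomp_diff hcomp_sum)
qed

lemma d_Fil_Suc: "a \<in> Fil p \<Longrightarrow> d a \<in> Fil (p + 1)"
  using d_approx[of a p 0] by (simp add: truncation_def)

lemma d_minus_b: "a \<in> Fil p \<Longrightarrow> d a - b [a] \<in> Fil (p + 3)"
  using d_approx[of a p 1] by (simp add: truncation_def twist_term_def algebra_simps)

lemma d_Par: "a \<in> Par k \<Longrightarrow> d a \<in> Par (k + 1)"
  using twist_Par[of a k] unfolding Par_iff hcomp_d by simp

lemma linear_twist: "Vector_Spaces.linear scale scale (twist n)"
  using linear_b_slot[of "replicate n h" "[]"] by (simp add: twist_term_def)

lemma linear_truncation: "Vector_Spaces.linear scale scale (truncation N)"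
  using linear_twist
  by (simp add: Vector_Spaces.linear_iff truncation_def sum.distrib scale_sum_right)

lemma linear_d: "Vector_Spaces.linear scale scale d"
  unfolding Vector_Spaces.linear_iff
proof (intro conjI allI vector_space_axioms)
  fix x y
  obtain p p' where p: "x \<in> Fil p" "y \<in> Fil p'"
    using exhaustive_Fil unfolding exhaustive_def by blast
  define q where "q = min p p'"
  have q: "x \<in> Fil q" "y \<in> Fil q" using p by (auto simp: q_def intro: Fil_antimono[rotated])
  have "d (x + y) - (d x + d y) \<in> Fil (q + 2 * int N + 1)" for N
  proof -
    interpret l: Vector_Spaces.linear scale scale "truncation N" by (fact linear_truncation)
    have "d (x + y) - (d x + d y) =
      (d (x + y) - truncation N (x + y)) - ((d x - truncation N x) + (d y - truncation N y))"
      by (simp add: l.add)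
    also have "\<dots> \<in> Fil (q + 2 * int N + 1)"
      by (intro subspace_diff[OF subspace_Fil] subspace_add[OF subspace_Fil] d_approx q)
    finally show ?thesis .
  qed
  from Fil_separated[OF this] show "d (x + y) = d x + d y" by simp
next
  fix c x
  obtain p where p: "x \<in> Fil p" using exhaustive_Fil unfolding exhaustive_def by blast
  have "d (scale c x) - scale c (d x) \<in> Fil (p + 2 * int N + 1)" for N
  proof -
    interpret l: Vector_Spaces.linear scale scale "truncation N" by (fact linear_truncation)
    have "d (scale c x) - scale c (d x) =
      (d (scale c x) - truncation N (scale c x)) - scale c (d x - truncation N x)"
      by (simp add: l.scale scale_right_diff_distrib)
    also have "\<dots> \<in> Fil (p + 2 * int N + 1)"
      by (intro subspace_diff[OF subspace_Fil] subspace_scale[OF subspace_Fil] d_approx p)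
    finally show ?thesis .
  qed
  from Fil_separated[OF this] show "d (scale c x) = scale c (d x)" by simp
qed

text \<open>
  Since \<open>d h = 0\<close>, a truncation of the series for \<open>d h\<close> is minus its remainder.
\<close>

lemma truncation_h: "truncation N h \<in> Fil (2 * int N + 3)"
proof -
  have "d h = 0" using twisting unfolding twisting_element_def by simp
  then show ?thesis
    using d_approx[OF h_Fil, of N] subspace_neg[OF subspace_Fil, of "d h - truncation N h"]
    by (simp add: algebra_simps)
qed

lemma truncation_Fil: "a \<in> Fil p \<Longrightarrow> truncation N a \<in> Fil (p + 1)"
  unfolding truncation_def
  by (intro subspace_sum[OF subspace_Fil] Fil_antimono[OF _ twist_Fil]) auto

text \<open>
  The sum of the relations on \<open>(h,\<dots>,h,a)\<close> with at most \<open>N\<close> arguments. In the first sum, the inner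
  operation takes \<open>a\<close> as its last argument; in the second, it is applied to copies of \<open>h\<close> only,
  and summing over the number of these copies produces a truncation of \<open>d h\<close>.
\<close>

lemma sum_stasheff_h:
  "(\<Sum>(r, m)\<in>{(r, m). r + m < N}. twist r (twist m a)) +
   (\<Sum>(r, t)\<in>{(r, t). r + t < N}.
      b (replicate r h @ truncation (N - 1 - (r + t)) h # replicate t h @ [a])) = 0"
proof -
  define T where "T r s t = stasheff_term r s (replicate (r + s + t - 1) h @ [a])" for r s t
  define J where "J n = {(r, s, t). s \<ge> 1 \<and> r + s + t = Suc n}" for n
  let ?I = "{(r, s, t). s \<ge> 1 \<and> r + s + t \<le> N}"
  let ?R = "{(r, t). r + t < N}"
  have fin: "finite ?I"
    by (rule finite_subset[of _ "{..N} \<times> {..N} \<times> {..N}"]) auto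
  have finR: "finite ?R" by (rule finite_subset[of _ "{..N} \<times> {..N}"]) auto
  have "(\<Sum>(r, s, t)\<in>J n. T r s t) = 0" for n
  proof -
    have "(\<Sum>(r, s, t)\<in>J n. T r s t) = (\<Sum>(r, s, t)\<in>J n. stasheff_term r s (replicate n h @ [a]))"
      unfolding J_def T_def by (rule sum.cong) auto
    then show ?thesis using even_relation[OF h_Par] by (simp add: J_def)
  qed
  then have "0 = (\<Sum>n<N. \<Sum>(r, s, t)\<in>J n. T r s t)" by simp
  also have "\<dots> = (\<Sum>(r, s, t)\<in>(\<Union>n<N. J n). T r s t)"
    by (rule sum.UNION_disjoint[symmetric]) (auto simp: J_def intro: finite_splittings[simplified])
  also have "(\<Union>n<N. J n) = ?I"
  proof -
    have "(\<exists>n<N. r + s + t = Suc n) \<longleftrightarrow> r + s + t \<le> N" if "s \<ge> 1" for r s t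
      using that by (auto intro!: exI[of _ "r + s + t - 1"])
    then show ?thesis unfolding J_def by (auto simp: Bex_def)
  qed
  also have "(\<Sum>(r, s, t)\<in>?I. T r s t) =
      (\<Sum>(r, s, t)\<in>{(r, s, t) \<in> ?I. t = 0}. T r s t) + (\<Sum>(r, s, t)\<in>{(r, s, t) \<in> ?I. t > 0}. T r s t)"
    using fin by (subst sum.union_disjoint[symmetric]) (auto intro!: sum.cong elim: finite_subset[rotated])
  also have "(\<Sum>(r, s, t)\<in>{(r, s, t) \<in> ?I. t = 0}. T r s t) = (\<Sum>(r, m)\<in>?R. twist r (twist m a))"
    by (rule sum.reindex_bij_witness[of _ "\<lambda>(r, m). (r, Suc m, 0)" "\<lambda>(r, s, t). (r, s - 1)"])
      (auto simp: T_def stasheff_term_def twist_term_def)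
  also have "(\<Sum>(r, s, t)\<in>{(r, s, t) \<in> ?I. t > 0}. T r s t) =
      (\<Sum>((r, t), s)\<in>Sigma ?R (\<lambda>(r, t). {..<N - 1 - (r + t)}). T r (Suc s) (Suc t))"
    by (rule sum.reindex_bij_witness[of _ "\<lambda>((r, t), s). (r, Suc s, Suc t)"
          "\<lambda>(r, s, t). ((r, t - 1), s - 1)"]) auto
  also have "\<dots> = (\<Sum>(r, t)\<in>?R. \<Sum>s<N - 1 - (r + t). T r (Suc s) (Suc t))"
    using finR by (subst sum.Sigma[symmetric]) (auto simp: case_prod_unfold)
  also have "\<dots> = (\<Sum>(r, t)\<in>?R. b (replicate r h @ truncation (N - 1 - (r + t)) h # replicate t h @ [a]))"
  proof (rule sum.cong, goal_cases)
    case (2 x)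
    obtain r t where x: "x = (r, t)" by fastforce
    interpret l: Vector_Spaces.linear scale scale "\<lambda>x. b (replicate r h @ x # replicate t h @ [a])"
      by (rule linear_b_slot)
    have "T r (Suc s) (Suc t) = b (replicate r h @ twist s h # replicate t h @ [a])" for s
    proof -
      have "replicate (r + Suc s + Suc t - 1) h = replicate r h @ replicate (Suc s) h @ replicate t h"
        by (simp only: replicate_add[symmetric]) simp
      then show ?thesis
        unfolding T_def stasheff_term_def twist_term_def replicate_append_same by simp
    qed
    then show ?case unfolding x by (simp add: truncation_def l.sum)
  qed simp
  finally show ?thesis by simp
qed

text \<open>
  In the square of a truncation, the terms with \<open>r + m \<ge> N\<close> are of high filtration. The
  others are, up to sign, the second sum in \<open>sum_stasheff_h\<close>, where the truncation of \<open>d h\<close>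
  has high filtration: the shorter the truncation, the more copies of \<open>h\<close> surround it.
\<close>

lemma truncation_truncation:
  assumes a: "a \<in> Fil p" shows "truncation N (truncation N a) \<in> Fil (p + 2 * int N + 2)"
proof -
  let ?R = "{(r, m). r + m < N}"
  have fin: "finite ({..<N} \<times> {..<N})" by simp
  have "truncation N (truncation N a) = (\<Sum>r<N. \<Sum>m<N. twist r (twist m a))"
  proof -
    have "twist r (\<Sum>m<N. twist m a) = (\<Sum>m<N. twist r (twist m a))" for r
    proof -
      interpret l: Vector_Spaces.linear scale scale "twist r" by (rule linear_twist)
      show ?thesis by (rule l.sum)
    qed
    then show ?thesis by (simp add: truncation_def)
  qed
  also have "\<dots> = (\<Sum>(r, m)\<in>{..<N} \<times> {..<N}. twist r (twist m a))"
    by (rule sum.cartesian_product)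
  also have "\<dots> = (\<Sum>(r, m)\<in>?R. twist r (twist m a)) +
      (\<Sum>(r, m)\<in>{..<N} \<times> {..<N} - ?R. twist r (twist m a))"
    by (subst add.commute, rule sum.subset_diff) auto
  finally have eq: "truncation N (truncation N a) = \<dots>" .
  have rest: "(\<Sum>(r, m)\<in>{..<N} \<times> {..<N} - ?R. twist r (twist m a)) \<in> Fil (p + 2 * int N + 2)"
  proof (rule subspace_sum[OF subspace_Fil])
    fix x assume "x \<in> {..<N} \<times> {..<N} - ?R"
    then obtain r m where x: "x = (r, m)" "N \<le> r + m" by auto
    have "twist r (twist m a) \<in> Fil (p + 2 * int m + 1 + 2 * int r + 1)"
      using a by (intro twist_Fil)
    moreover have "p + 2 * int N + 2 \<le> p + 2 * int m + 1 + 2 * int r + 1" using x(2) by simp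
    ultimately show "(case x of (r, m) \<Rightarrow> twist r (twist m a)) \<in> Fil (p + 2 * int N + 2)"
      unfolding x(1) prod.case by (rule Fil_antimono[rotated])
  qed
  have S: "(\<Sum>(r, t)\<in>?R. b (replicate r h @ truncation (N - 1 - (r + t)) h # replicate t h @ [a]))
      \<in> Fil (p + 2 * int N + 2)" (is "?S \<in> _")
  proof (rule subspace_sum[OF subspace_Fil])
    fix x assume "x \<in> ?R"
    then obtain r t where x: "x = (r, t)" and rt: "r + t < N" by auto
    let ?K = "N - 1 - (r + t)"
    have "list_all2 (\<lambda>x p. x \<in> Fil p) (replicate r h @ truncation ?K h # replicate t h @ [a])
        (replicate r 2 @ (2 * int ?K + 3) # replicate t 2 @ [p])"
      using h_Fil a truncation_h
      by (intro list_all2_appendI list.rel_intros(2)) (auto simp: list_all2_conv_all_nth)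
    from b_Fil[OF this] rt
    show "(case x of (r, t) \<Rightarrow> b (replicate r h @ truncation (N - 1 - (r + t)) h # replicate t h @ [a]))
        \<in> Fil (p + 2 * int N + 2)"
      by (simp add: x sum_list_replicate of_nat_diff algebra_simps)
  qed
  have eq': "(\<Sum>(r, m)\<in>?R. twist r (twist m a)) = - ?S"
    using sum_stasheff_h[of a N] by (simp only: eq_neg_iff_add_eq_0)
  show ?thesis
    unfolding eq eq' by (intro subspace_add[OF subspace_Fil] subspace_neg[OF subspace_Fil] rest S)
qed

lemma d_d_eq_0: "d (d a) = 0"
proof -
  obtain p where p: "a \<in> Fil p" using exhaustive_Fil unfolding exhaustive_def by blast
  have "d (d a) \<in> Fil (p + 2 * int N + 1)" for N
  proof -
    interpret l: Vector_Spaces.linear scale scale "truncation N" by (fact linear_truncation)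
    have "d (d a) = (d (d a) - truncation N (d a)) + (truncation N (d a - truncation N a) +
        truncation N (truncation N a))" by (simp add: l.diff)
    moreover have "d (d a) - truncation N (d a) \<in> Fil (p + 2 * int N + 1)"
      using d_approx[OF d_Fil_Suc[OF p]] by (rule Fil_antimono[rotated]) simp
    moreover have "truncation N (d a - truncation N a) \<in> Fil (p + 2 * int N + 1)"
      using truncation_Fil[OF d_approx[OF p]] by (rule Fil_antimono[rotated]) simp
    moreover have "truncation N (truncation N a) \<in> Fil (p + 2 * int N + 1)"
      using truncation_truncation[OF p] by (rule Fil_antimono[rotated]) simp
    ultimately show ?thesis by (metis subspace_add[OF subspace_Fil])
  qed
  then show ?thesis by (rule Fil_separated)
qed

lemma filtered_complex_d: "filtered_Z2_complex scale Fil Par d"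
proof -
  have 1: "Par (k + 2) = Par k" for k by (auto simp: parity_part_def)
  have 2: "Par k \<inter> Par (k + 1) = {0}" for k
  proof -
    have "Par k \<inter> Par (k + 1) = dsum_over scale A {}"
      unfolding parity_part_def dsum_Int by (rule arg_cong[of _ _ "dsum_over scale A"]) (auto; presburger)
    then show ?thesis by (simp add: dsum_over_def)
  qed
  have 3: "Par k + Par (k + 1) = UNIV" for k
  proof -
    have "{n. n mod 2 = k mod 2} \<union> {n. n mod 2 = (k + 1) mod 2} = UNIV" by (auto; presburger)
    then have "x \<in> Par k + Par (k + 1)" for x
      unfolding parity_part_def by (intro dsum_split) (auto simp: dsum_iff)
    then show ?thesis by auto
  qed
  have 4: "Fil (p + 1) \<subseteq> Fil p" for p using Fil_antimono[of p "p + 1"] by auto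
  have 5: "Fil p = Fil p \<inter> Par 0 + Fil p \<inter> Par 1" for p
  proof (rule antisym)
    have "{p..} = ({p..} \<inter> {n. n mod 2 = 0 mod 2}) \<union> ({p..} \<inter> {n. n mod 2 = 1 mod 2})"
      by (auto; presburger)
    then show "Fil p \<subseteq> Fil p \<inter> Par 0 + Fil p \<inter> Par 1"
      unfolding degree_filtration_def parity_part_def dsum_Int by (metis dsum_split subsetI)
    show "Fil p \<inter> Par 0 + Fil p \<inter> Par 1 \<subseteq> Fil p"
      using subspace_add[OF subspace_Fil] by (auto elim!: set_plus_elim)
  qed
  have 6: "d ` Fil p \<subseteq> Fil p" for p
  proof (rule image_subsetI)
    fix x assume "x \<in> Fil p"
    then have "d x \<in> Fil (p + 1)" by (rule d_Fil_Suc)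
    then show "d x \<in> Fil p" by (rule Fil_antimono[rotated]) simp
  qed
  have 7: "d ` Par k \<subseteq> Par (k + 1)" for k by (rule image_subsetI) (rule d_Par)
  show ?thesis
    unfolding filtered_Z2_complex_def
    by (intro conjI allI) (fact subspace_Par subspace_Fil linear_d d_d_eq_0 1 2 3 4 5 6 7)+
qed

end


section \<open>The spectral sequence of a twisting element of positive degree\<close>

sublocale positively_twisted \<subseteq> complex: filtered_complex scale Fil Par d
  by unfold_locales (fact filtered_complex_d)

context positively_twisted
begin

abbreviation "E \<equiv> ss_E scale Fil Par d"

lemma Fil_Par_Suc_odd: "odd q \<Longrightarrow> Fil (p + 1) \<inter> Par (p + q) = Fil p \<inter> Par (p + q)"
  by (rule Fil_Par_Suc) simp

text \<open>
  In an odd row the whole of \<open>F p\<close> of the relevant parity lies in \<open>F (p + 1)\<close>.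
\<close>

lemma E_odd:
  assumes "odd q" shows "carrier (E r p q) = {vzero (E r p q)}"
proof -
  have zero: "0 \<in> complex.Z_lift r p q" by (rule subspace_0[OF complex.subspace_Z_lift])
  have "ss_class scale Fil Par d r p q x = ss_class scale Fil Par d r p q 0"
    if x: "x \<in> complex.Z_lift r p q" for x
  proof -
    have "x \<in> Fil (p + 1) \<inter> Par (p + q)"
      using x unfolding complex.Z_lift_def Fil_Par_Suc_odd[OF assms] by simp
    then have "x - 0 \<in> complex.E_kernel r p q" using complex.FP_subset_E_kernel by auto
    then show ?thesis using complex.presents_eq_iff[OF complex.presents_E x zero] by (rule iffD2[rotated])
  qed
  then show ?thesis
    unfolding complex.presents_carrier[OF complex.presents_E]
      complex.presents_vzero[OF complex.presents_E] using zero by blast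
qed

text \<open>
  An even \<open>r\<close> makes \<open>d\<^sub>r\<close> change the parity of the row, so its source or its target is zero.
\<close>

lemma ss_d_even:
  assumes "even r" and \<xi>: "\<xi> \<in> carrier (E r p q)"
  shows "ss_d scale Fil Par d r p q \<xi> = vzero (E r (p + int r) (q - int r + 1))"
proof (cases "even q")
  case True
  then have "odd (q - int r + 1)" using assms(1) by simp
  moreover have "ss_d scale Fil Par d r p q \<xi> \<in> carrier (E r (p + int r) (q - int r + 1))"
    using complex.lin_map_ss_d \<xi> unfolding lin_map_def by blast
  ultimately show ?thesis using E_odd by simp
next
  case False
  then have "\<xi> = ss_class scale Fil Par d r p q 0"
    using \<xi> E_odd[of q r p] unfolding complex.presents_vzero[OF complex.presents_E] by simp
  then show ?thesis
    by (simp only: complex.ss_d_class[OF subspace_0[OF complex.subspace_Z_lift]] complex.d_0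
        complex.presents_vzero[OF complex.presents_E])
qed

text \<open>
  For cycles, \<open>d x\<close> has the parity opposite to \<open>p + r\<close>, so lying in step \<open>p + r\<close> is the same as
  lying in step \<open>p + r + 1\<close>; for boundaries, the same holds for \<open>y\<close> and step \<open>p - r\<close>.
\<close>

lemma E_even_Suc:
  assumes "even q" "even r" shows "E r p q = E (Suc r) p q"
proof -
  have "complex.Z_lift r p q = complex.Z_lift (Suc r) p q"
  proof -
    have "d x \<in> Fil (p + int r) \<longleftrightarrow> d x \<in> Fil (p + int (Suc r))" if "x \<in> Par (p + q)" for x
      using d_Par[OF that] Fil_Par_Suc[of "p + int r" "p + q + 1"] assms by (auto simp: algebra_simps)
    then show ?thesis unfolding complex.Z_lift_def by auto
  qed
  moreover have "complex.B_lift r p q = complex.B_lift (Suc r) p q"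
    using Fil_Par_Suc[of "p - int r" "p + q - 1"] assms
    unfolding complex.B_lift_def by (simp add: algebra_simps)
  ultimately show ?thesis
    unfolding ss_E_def complex.ss_Z_eq complex.ss_B_eq by simp
qed

lemma homogeneous_FP: "x \<in> A p \<Longrightarrow> even q \<Longrightarrow> x \<in> Fil p \<inter> Par (p + q)"
  by (auto simp: Fil_iff Par_iff hcomp_homogeneous)

lemma hcomp_d_Suc:
  assumes "x \<in> Fil p" shows "hcomp A (p + 1) (d x) = b [hcomp A p x]"
proof -
  have x': "x - hcomp A p x \<in> Fil (p + 1)"
    using assms by (auto simp: Fil_iff hcomp_diff hcomp_homogeneous[OF hcomp_in])
  have lead: "b [hcomp A p x] \<in> A (p + 1)"
    using b_degree[of "[hcomp A p x]" "[p]"] hcomp_in by simp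
  have "d x - b [hcomp A p x] = d (x - hcomp A p x) + (d (hcomp A p x) - b [hcomp A p x])"
    by (simp add: complex.d_diff)
  also have "\<dots> \<in> Fil (p + 2)"
  proof (rule subspace_add[OF subspace_Fil])
    show "d (x - hcomp A p x) \<in> Fil (p + 2)" using d_Fil_Suc[OF x'] by (simp add: add.commute)
    have "hcomp A p x \<in> Fil p" using homogeneous_FP[OF hcomp_in, of 0 p x] by simp
    then show "d (hcomp A p x) - b [hcomp A p x] \<in> Fil (p + 2)"
      using d_minus_b by (intro Fil_antimono[of "p + 2" "p + 3"]) simp_all
  qed
  finally have "hcomp A (p + 1) (d x) - hcomp A (p + 1) (b [hcomp A p x]) = 0"
    by (simp add: Fil_iff hcomp_diff)
  then show ?thesis using hcomp_homogeneous[OF lead, of "p + 1"] by simp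
qed

lemma presents_cohomology:
  "complex.presents (cohomology scale A b p) {x \<in> A p. b [x] = 0} ((\<lambda>x. b [x]) ` A (p - 1))
     (\<lambda>x. x +o (\<lambda>y. b [y]) ` A (p - 1))"
proof -
  interpret l: Vector_Spaces.linear scale scale "\<lambda>x. b [x]"
    using linear_b_slot[of "[]" "[]"] by simp
  have "{x \<in> A p. b [x] = 0} = A p \<inter> (\<lambda>x. b [x]) -` {0}" by auto
  then have S: "subspace {x \<in> A p. b [x] = 0}"
    using subspace_inter[OF subspace_component l.subspace_vimage[OF subspace_single_0]] by simp
  have "(\<lambda>x. b [x]) ` A (p - 1) \<subseteq> {x \<in> A p. b [x] = 0}"
    using b_degree[of "[x]" "[p - 1]" for x] b_b by auto
  from complex.presents_quot[OF complex.presents_sub[OF complex.presents_whole S]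
      l.subspace_image[OF subspace_component] this]
  show ?thesis unfolding cohomology_def by simp
qed

text \<open>
  A cocycle \<open>x\<close> of \<open>b\<^sub>1\<close> in degree \<open>p\<close> satisfies \<open>d x \<in> F (p + 3)\<close>, so it is a lift of a cycle for page 2.
  Conversely, the degree \<open>p\<close> component of such a lift is a cocycle of \<open>b\<^sub>1\<close> in the same class.
  The kernels agree because \<open>d y\<close> and \<open>b\<^sub>1\<close> of the lowest component of \<open>y\<close> have the same
  lowest component.
\<close>

lemma cohomology_iso_E2:
  assumes q: "even q"
  shows "\<exists>f. lin_iso (cohomology scale A b p) (E 2 p q) f \<and>
    (\<forall>x\<in>{x \<in> A p. b [x] = 0}.
       f (x +o (\<lambda>y. b [y]) ` A (p - 1)) = ss_class scale Fil Par d 2 p q x)"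
proof (rule complex.presents_lin_iso[OF presents_cohomology complex.presents_E])
  show sub: "{x \<in> A p. b [x] = 0} \<subseteq> complex.Z_lift 2 p q"
  proof clarify
    fix x assume x: "x \<in> A p" "b [x] = 0"
    have "d x \<in> Fil (p + 3)" using d_minus_b[of x p] homogeneous_FP[OF x(1) q] x(2) by simp
    then have "d x \<in> Fil (p + 2)" by (rule Fil_antimono[rotated]) simp
    then show "x \<in> complex.Z_lift 2 p q"
      using homogeneous_FP[OF x(1) q] by (simp add: complex.Z_lift_def)
  qed
next
  fix x assume "x \<in> {x \<in> A p. b [x] = 0}"
  then have x: "x \<in> A p" by simp
  show "x \<in> (\<lambda>x. b [x]) ` A (p - 1) \<longleftrightarrow> x \<in> complex.E_kernel 2 p q"
  proof
    assume "x \<in> (\<lambda>x. b [x]) ` A (p - 1)"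
    then obtain y where y: "y \<in> A (p - 1)" "x = b [y]" by auto
    have yFP: "y \<in> Fil (p - 1) \<inter> Par (p + q - 1)" using homogeneous_FP[OF y(1) q] by (simp add: algebra_simps)
    have dy: "d y \<in> Fil p \<inter> Par (p + q)"
      using d_Fil_Suc[of y "p - 1"] d_Par[of y "p + q - 1"] yFP by simp
    then have "d y \<in> complex.B_lift 2 p q"
      unfolding complex.B_lift_def using yFP by auto
    moreover have "x - d y \<in> Fil (p + 1) \<inter> Par (p + q)"
    proof -
      have "- (d y - b [y]) \<in> Fil (p - 1 + 3)" using d_minus_b yFP subspace_neg[OF subspace_Fil] by blast
      then have "x - d y \<in> Fil (p + 1)" unfolding y(2) by (intro Fil_antimono[of "p + 1" "p + 2"]) (simp_all add: add.commute)
      moreover have "x - d y \<in> Par (p + q)"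
        using homogeneous_FP[OF x q] dy by (intro subspace_diff[OF subspace_Par]) auto
      ultimately show ?thesis by simp
    qed
    ultimately have "d y + (x - d y) \<in> complex.E_kernel 2 p q"
      unfolding complex.E_kernel_def by (rule set_plus_intro)
    then show "x \<in> complex.E_kernel 2 p q" by simp
  next
    assume "x \<in> complex.E_kernel 2 p q"
    then obtain y z where y: "y \<in> Fil (p - 1)" and z: "z \<in> Fil (p + 1)" and "x = d y + z"
      unfolding complex.E_kernel_def complex.B_lift_def by (auto elim!: set_plus_elim)
    then have "hcomp A p x = b [hcomp A (p - 1) y]"
      using hcomp_d_Suc[OF y] by (simp add: hcomp_add Fil_iff)
    then have "x = b [hcomp A (p - 1) y]" using hcomp_homogeneous[OF x] by simp
    then show "x \<in> (\<lambda>x. b [x]) ` A (p - 1)" using hcomp_in by blast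
  qed
next
  fix y assume y: "y \<in> complex.Z_lift 2 p q"
  let ?x = "hcomp A p y"
  have "b [?x] = hcomp A (p + 1) (d y)" using y by (simp add: hcomp_d_Suc complex.Z_lift_def)
  also have "\<dots> = 0" using y by (simp add: complex.Z_lift_def Fil_iff)
  finally have "?x \<in> {x \<in> A p. b [x] = 0}" using hcomp_in by simp
  moreover have "y - ?x \<in> Fil (p + 1) \<inter> Par (p + q)"
    using y q by (auto simp: complex.Z_lift_def Fil_iff Par_iff hcomp_diff hcomp_homogeneous[OF hcomp_in])
  ultimately show "\<exists>x\<in>{x \<in> A p. b [x] = 0}. y - x \<in> complex.E_kernel 2 p q"
    using complex.FP_subset_E_kernel by blast
qed

end

theorem lemma5p1:
  fixes scale :: "'k::field \<Rightarrow> 'a::ab_group_add \<Rightarrow> 'a"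
    and A :: "int \<Rightarrow> 'a set" and b :: "'a list \<Rightarrow> 'a" and h :: 'a
    and d :: "'a \<Rightarrow> 'a" and P F :: "int \<Rightarrow> 'a set"
    and E :: "nat \<Rightarrow> int \<Rightarrow> int \<Rightarrow> ('k, 'a set set) vspace"
  assumes "ainfty_algebra scale A b"
    and "twisting_element scale A b h"
    and "positive_degree scale A h"
    and d: "d = twist_diff A b h"
    and P: "P = parity_part scale A"
    and F: "F = degree_filtration scale A"
    and E: "E = ss_E scale F P d"
  shows "filtered_Z2_complex scale F P d \<and>
    is_spectral_sequence scale F P d \<and>
    exhaustive F \<and>
    (weakly_convergent scale F P d \<longrightarrow> ss_converges scale F P d) \<and>
    (\<forall>r p q. odd q \<longrightarrow> carrier (E r p q) = {vzero (E r p q)}) \<and>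
    (\<forall>r p q. even r \<longrightarrow>
       (\<forall>\<xi> \<in> carrier (E r p q).
          ss_d scale F P d r p q \<xi> = vzero (E r (p + int r) (q - int r + 1)))) \<and>
    (\<forall>m p q. m \<ge> 1 \<longrightarrow> even q \<longrightarrow> E (2 * m) p q = E (2 * m + 1) p q) \<and>
    (\<forall>p q. even q \<longrightarrow> E 2 p q = E 3 p q \<and>
       (\<exists>f. lin_iso (cohomology scale A b p) (E 2 p q) f \<and>
          (\<forall>x \<in> A p. b [x] = 0 \<longrightarrow>
             f (x +o (\<lambda>y. b [y]) ` A (p - 1)) = ss_class scale F P d 2 p q x)))"
proof -
  interpret ainfty_algebra scale A b by (fact assms(1))
  interpret positively_twisted scale A b h
    by unfold_locales (fact assms(2) assms(3))+
  have E3: "ss_E scale F P d 2 p q = ss_E scale F P d 3 p q" if "even q" for p q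
    using E_even_Suc[OF that, of 2 p] unfolding d P F by (simp add: eval_nat_numeral)
  have H: "\<exists>f. lin_iso (cohomology scale A b p) (ss_E scale F P d 2 p q) f \<and>
          (\<forall>x \<in> A p. b [x] = 0 \<longrightarrow>
             f (x +o (\<lambda>y. b [y]) ` A (p - 1)) = ss_class scale F P d 2 p q x)"
    if "even q" for p q
    using cohomology_iso_E2[OF that, of p] unfolding d P F by (simp add: Ball_def imp_conjL)
  show ?thesis
    unfolding E
    using E3 H filtered_complex_d complex.spectral_sequence exhaustive_Fil
      complex.convergence[OF exhaustive_Fil] E_odd ss_d_even E_even_Suc
    unfolding d P F by simp
qed

end
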